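(* Let $p\ge1$ be an integer and let $\Psi_{\boldsymbol h}^p\in \Pi_{h_{\boldsymbol x}}\Psi_0+S^p_{h_t,0,\bullet}(0,T;\mathbb C)\otimes S_{h_{\boldsymbol x}}(\Omega)$ be a solution of the space–time method with zero forcing term $F\equiv0$, i.e. $$\mathrm i(\partial_t\Psi_{\boldsymbol h}^p,W)_{Q_T}-\tfrac12(\nabla_{\boldsymbol x}\Psi_{\boldsymbol h}^p,\nabla_{\boldsymbol x}W)_{Q_T}+(V\Psi_{\boldsymbol h}^p,W)_{Q_T}=0\qquad\text{for all } W\in S^{p-1}_{h_t}(0,T;\mathbb C)\otimes S_{h_{\boldsymbol x}}(\Omega).$$ Then the mass and the energy are conserved at the final time: $$\mathcal M_{\Psi_{\boldsymbol h}^p}(T)=\mathcal M_{\Psi_{\boldsymbol h}^p}(0)\qquad\text{and}\qquad \mathcal E_{\Psi_{\boldsymbol h}^p}(T)=\mathcal E_{\Psi_{\boldsymbol h}^p}(0).$$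
   Context: Let $\Omega\subset\mathbb R^d$ be an open bounded Lipschitz domain, $T>0$, $Q_T=\Omega\times(0,T)$, $V\in L^\infty(\Omega)$ real-valued, $\Psi_0\in H_0^1(\Omega)$. Functions are complex-valued; $(u,v)_{Q_T}=\int_{Q_T}u\,\overline v$, and $\nabla_{\boldsymbol x}$ is the spatial gradient. Temporal spaces: for $N_t\in\mathbb N$, $N_t\ge1$, let $h_t=T/N_t$, $t_j=jh_t$. For $q\ge0$, $S^q_{h_t}(0,T;\mathbb C)$ is the space of complex-valued functions that are polynomials of degree at most $q$ on each $(t_{j-1},t_j)$, $j=1,\dots,N_t$, and belong to $C^{q-1}([0,T])$ (no continuity is required when $q=0$). $S^q_{h_t,0,\bullet}(0,T;\mathbb C)$ is the subspace of functions vanishing at $t=0$. Spatial space: $S_{h_{\boldsymbol x}}(\Omega)$ is any finite-dimensional (conforming) subspace of $H_0^1(\Omega)$, and $\Pi_{h_{\boldsymbol x}}\Psi_0\in S_{h_{\boldsymbol x}}(\Omega)$ is an arbitrary approximation of $\Psi_0$, regarded as a function constant in time. $\otimes$ is the algebraic tensor product, i.e. the span of the products $v(t)\Phi(\boldsymbol x)$. Functionals: $\mathcal M_\Psi(t)=\int_\Omega|\Psi(\boldsymbol x,t)|^2\,d\boldsymbol x$ and $\mathcal E_\Psi(t)=-\tfrac12\int_\Omega|\nabla_{\boldsymbol x}\Psi(\boldsymbol x,t)|^2\,d\boldsymbol x+\int_\Omega V(\boldsymbol x)|\Psi(\boldsymbol x,t)|^2\,d\boldsymbol x$. *)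

theory Defs
  imports "HOL-Analysis.Analysis" "HOL-Library.Function_Algebras"
    "HOL-Computational_Algebra.Polynomial"
begin

text \<open>
  Functions are total; only their values on the set under consideration (up to a.e.\ equality
  in space) matter. Space-time functions take a pair \<open>(x, t)\<close>.
\<close>

global_interpretation cfun: vector_space "\<lambda>(c::complex) (f::'a \<Rightarrow> complex) x. c * f x"
  by unfold_locales (auto simp: algebra_simps)


subsection \<open>Differentiability classes and test functions\<close>

text \<open>
  Derivatives are taken within \<open>S\<close>. This is used only for \<open>S = UNIV\<close> and for nondegenerate compact
  intervals, where they are unique and this is the usual class \<open>C\<^sup>n(S)\<close>.
\<close>

primrec Ck_on :: "nat \<Rightarrow> 'a::euclidean_space set \<Rightarrow> ('a \<Rightarrow> complex) \<Rightarrow> bool" where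
  "Ck_on 0 S f \<longleftrightarrow> continuous_on S f"
| "Ck_on (Suc n) S f \<longleftrightarrow> f differentiable_on S \<and>
     (\<forall>b\<in>Basis. Ck_on n S (\<lambda>x. frechet_derivative f (at x within S) b))"

definition test_functions :: "'a::euclidean_space set \<Rightarrow> ('a \<Rightarrow> complex) set" where
  "test_functions U = {\<phi>. (\<forall>n. Ck_on n UNIV \<phi>) \<and>
     compact (closure {x. \<phi> x \<noteq> 0}) \<and> closure {x. \<phi> x \<noteq> 0} \<subseteq> U}"


subsection \<open>Lebesgue and Sobolev spaces\<close>

definition L2 :: "'a::euclidean_space set \<Rightarrow> ('a \<Rightarrow> complex) set" where
  "L2 U = {u \<in> borel_measurable (lebesgue_on U). integrable (lebesgue_on U) (\<lambda>x. (norm (u x))\<^sup>2)}"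

definition Linfinity :: "'a::euclidean_space set \<Rightarrow> ('a \<Rightarrow> real) set" where
  "Linfinity U = {V \<in> borel_measurable (lebesgue_on U). \<exists>C. AE x in lebesgue_on U. \<bar>V x\<bar> \<le> C}"

definition has_weak_deriv ::
  "'a::euclidean_space set \<Rightarrow> 'a \<Rightarrow> ('a \<Rightarrow> complex) \<Rightarrow> ('a \<Rightarrow> complex) \<Rightarrow> bool" where
  "has_weak_deriv U e u g \<longleftrightarrow> (\<forall>\<phi>\<in>test_functions U.
     (LINT x|lebesgue_on U. u x * frechet_derivative \<phi> (at x) e) =
     - (LINT x|lebesgue_on U. g x * \<phi> x))"

text \<open>
  The weak derivative of \<open>u\<close> in direction \<open>e\<close>; it is determined up to a null subset of the open
  set \<open>U\<close>, and is a junk value if \<open>u\<close> has no square-integrable weak derivative.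
\<close>

definition weak_deriv ::
  "'a::euclidean_space set \<Rightarrow> 'a \<Rightarrow> ('a \<Rightarrow> complex) \<Rightarrow> 'a \<Rightarrow> complex" where
  "weak_deriv U e u = (SOME g. g \<in> L2 U \<and> has_weak_deriv U e u g)"

definition grad :: "(real^'d) set \<Rightarrow> (real^'d \<Rightarrow> complex) \<Rightarrow> real^'d \<Rightarrow> complex^'d" where
  "grad \<Omega> u x = (\<chi> i. weak_deriv \<Omega> (axis i 1) u x)"

definition H1 :: "(real^'d) set \<Rightarrow> (real^'d \<Rightarrow> complex) set" where
  "H1 \<Omega> = {u \<in> L2 \<Omega>. \<forall>i. \<exists>g \<in> L2 \<Omega>. has_weak_deriv \<Omega> (axis i 1) u g}"

definition H1_norm :: "(real^'d) set \<Rightarrow> (real^'d \<Rightarrow> complex) \<Rightarrow> real" where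
  "H1_norm \<Omega> u = sqrt ((LINT x|lebesgue_on \<Omega>. (norm (u x))\<^sup>2) +
                       (LINT x|lebesgue_on \<Omega>. (norm (grad \<Omega> u x))\<^sup>2))"

definition H10 :: "(real^'d) set \<Rightarrow> (real^'d \<Rightarrow> complex) set" where
  "H10 \<Omega> = {u \<in> H1 \<Omega>. \<forall>\<epsilon>>0. \<exists>\<phi>\<in>test_functions \<Omega>. H1_norm \<Omega> (\<lambda>x. u x - \<phi> x) < \<epsilon>}"


subsection \<open>Lipschitz domains\<close>

text \<open>
  Near each boundary point, \<open>\<Omega>\<close> is the part above the graph of a Lipschitz function \<open>\<gamma>\<close> over the
  hyperplane orthogonal to a unit vector \<open>n\<close>; \<open>y - (y \<bullet> n) *\<^sub>R n\<close> is the projection onto that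
  hyperplane. Connectedness is not required.
\<close>

definition lipschitz_domain :: "(real^'d) set \<Rightarrow> bool" where
  "lipschitz_domain \<Omega> \<longleftrightarrow> open \<Omega> \<and> (\<forall>z\<in>frontier \<Omega>. \<exists>r>0. \<exists>n \<gamma> L. norm n = 1 \<and>
     L-lipschitz_on {y. y \<bullet> n = 0} \<gamma> \<and>
     \<Omega> \<inter> ball z r = {y \<in> ball z r. \<gamma> (y - (y \<bullet> n) *\<^sub>R n) < y \<bullet> n})"


subsection \<open>Discrete spaces\<close>

text \<open>For \<open>q = 0\<close> the values at the nodes \<open>j * T / N\<close> are unconstrained.\<close>

definition spline_space :: "real \<Rightarrow> nat \<Rightarrow> nat \<Rightarrow> (real \<Rightarrow> complex) set" where
  "spline_space T N q = {v.
     (\<forall>j\<in>{1..N}. \<exists>P::complex poly. degree P \<le> q \<and>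
        (\<forall>t\<in>{real (j - 1) * (T / real N)<..<real j * (T / real N)}. v t = poly P (of_real t))) \<and>
     (q \<ge> 1 \<longrightarrow> Ck_on (q - 1) {0..T} v)}"

definition spline_space0 :: "real \<Rightarrow> nat \<Rightarrow> nat \<Rightarrow> (real \<Rightarrow> complex) set" where
  "spline_space0 T N q = {v \<in> spline_space T N q. v 0 = 0}"

definition finite_dim_subspace :: "('a \<Rightarrow> complex) set \<Rightarrow> bool" where
  "finite_dim_subspace S \<longleftrightarrow> (\<exists>B. finite B \<and> S = cfun.span B)"

definition tensor ::
  "(real \<Rightarrow> complex) set \<Rightarrow> ('a \<Rightarrow> complex) set \<Rightarrow> ('a \<times> real \<Rightarrow> complex) set" where
  "tensor St Sx = cfun.span {\<lambda>(x, t). v t * \<Phi> x | v \<Phi>. v \<in> St \<and> \<Phi> \<in> Sx}"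


subsection \<open>Space-time forms, mass and energy\<close>

definition cylinder :: "'a set \<Rightarrow> real \<Rightarrow> ('a \<times> real) set" where
  "cylinder \<Omega> T = \<Omega> \<times> {0<..<T}"

definition time_deriv ::
  "(real^'d) set \<Rightarrow> real \<Rightarrow> ((real^'d) \<times> real \<Rightarrow> complex) \<Rightarrow> (real^'d) \<times> real \<Rightarrow> complex" where
  "time_deriv \<Omega> T u = weak_deriv (cylinder \<Omega> T) (0, 1) u"

definition space_grad ::
  "(real^'d) set \<Rightarrow> real \<Rightarrow> ((real^'d) \<times> real \<Rightarrow> complex) \<Rightarrow> (real^'d) \<times> real \<Rightarrow> complex^'d" where
  "space_grad \<Omega> T u z = (\<chi> i. weak_deriv (cylinder \<Omega> T) (axis i 1, 0) u z)"

definition L2_prod ::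
  "'a::euclidean_space set \<Rightarrow> ('a \<Rightarrow> complex) \<Rightarrow> ('a \<Rightarrow> complex) \<Rightarrow> complex" where
  "L2_prod Q u v = (LINT z|lebesgue_on Q. u z * cnj (v z))"

definition L2_prod_vec ::
  "'a::euclidean_space set \<Rightarrow> ('a \<Rightarrow> complex^'d) \<Rightarrow> ('a \<Rightarrow> complex^'d) \<Rightarrow> complex" where
  "L2_prod_vec Q u v = (LINT z|lebesgue_on Q. (\<Sum>i\<in>UNIV. u z $ i * cnj (v z $ i)))"

definition mass :: "(real^'d) set \<Rightarrow> ((real^'d) \<times> real \<Rightarrow> complex) \<Rightarrow> real \<Rightarrow> real" where
  "mass \<Omega> \<Psi> t = (LINT x|lebesgue_on \<Omega>. (norm (\<Psi> (x, t)))\<^sup>2)"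

definition energy ::
  "(real^'d) set \<Rightarrow> (real^'d \<Rightarrow> real) \<Rightarrow> ((real^'d) \<times> real \<Rightarrow> complex) \<Rightarrow> real \<Rightarrow> real" where
  "energy \<Omega> V \<Psi> t =
     - (1/2) * (LINT x|lebesgue_on \<Omega>. (norm (grad \<Omega> (\<lambda>y. \<Psi> (y, t)) x))\<^sup>2)
     + (LINT x|lebesgue_on \<Omega>. V x * (norm (\<Psi> (x, t)))\<^sup>2)"

end

theory Submission
  imports Defs
begin

text \<open>
  Write \<open>\<Psi> = \<Sum>\<^sub>k v\<^sub>k(t) \<phi>\<^sub>k(x)\<close>. Testing with \<open>W = \<partial>\<^sub>t \<Psi>\<close> and taking real parts gives the energy identity.
  For the mass, \<open>\<Psi>\<close> itself is not admissible, so one tests with its \<open>L\<^sup>2\<close> projection in time; it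
  suffices to project onto the span of the finitely many derivatives \<open>v\<^sub>k'\<close>. The projection leaves
  \<open>(\<partial>\<^sub>t \<Psi>, W)\<close> unchanged and makes the two remaining terms real, so imaginary parts give the mass
  identity.

  The weak derivatives in the scheme are chosen by a description operator, so they have to be
  identified almost everywhere with the expected sums. This rests on the fundamental lemma of the
  calculus of variations and on computing the weak derivatives of \<open>v(t) \<phi>(x)\<close> on the cylinder.
\<close>

section \<open>Smooth bump functions and the fundamental lemma\<close>

text \<open>The spatial data enter only through Gram matrices of the finitely many factors:
  \<open>M\<close> for the mass and \<open>H\<close> for -1/2 times the gradient form plus the
  potential. Both are Hermitian because V is real, and what remains is a statement about coefficient
  functions of time. There the projection w_l of v_l is used twice: (v_k', w_l) = (v_k', v_l), since
  a derivative sees only the component along the derivatives, and (v_k, w_l) = (w_k, w_l), since w_l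
  is itself a combination of derivatives. The second identity turns the \<open>H\<close> term into a
  Hermitian form at (w, w), which is real. Projecting onto the span of the v_k' avoids any basis of
  the spline space: admissibility only asks that each v_k' be a spline of degree p - 1. The obstacle
  is measure-theoretic. Spatial functions are merely Lebesgue measurable and the v_k' may be
  arbitrary at the nodes, so Fubini goes through Borel representatives, and time factors are handled
  as bounded Borel functions.\<close>

lemma Ck_on_SucI:
  assumes "\<And>x. (f has_derivative f' x) (at x)"
    and "\<And>b. b \<in> Basis \<Longrightarrow> Ck_on n UNIV (\<lambda>x. f' x b)"
  shows "Ck_on (Suc n) UNIV f"
proof -
  have "frechet_derivative f (at x) = f' x" for x
    using frechet_derivative_at[OF assms(1)] by metis
  then show ?thesis
    using assms by (auto simp: differentiable_on_def differentiable_def)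
qed

lemma Ck_on_has_derivative:
  assumes "Ck_on (Suc n) UNIV f"
  shows "(f has_derivative frechet_derivative f (at x)) (at x)"
  using assms by (auto simp: differentiable_on_def frechet_derivative_works)

lemma Ck_on_frechet_derivative:
  assumes "Ck_on (Suc n) UNIV f" "b \<in> Basis"
  shows "Ck_on n UNIV (\<lambda>x. frechet_derivative f (at x) b)"
  using assms by auto

lemma Ck_on_Suc_imp: "Ck_on (Suc n) S f \<Longrightarrow> Ck_on n S f"
proof (induction n arbitrary: f)
  case 0
  then show ?case by (simp add: differentiable_imp_continuous_on)
next
  case (Suc n)
  then show ?case by (metis Ck_on.simps(2))
qed

lemma Ck_on_imp_continuous_on: "Ck_on n S f \<Longrightarrow> continuous_on S f"
  by (cases n) (auto intro: differentiable_imp_continuous_on)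

lemma Ck_on_zero_UNIV: "Ck_on n UNIV (\<lambda>x. 0)"
  by (induction n) auto

lemma Ck_on_const_UNIV: "Ck_on n UNIV (\<lambda>x. c)"
proof (cases n)
  case (Suc m)
  then show ?thesis
    by (simp only:) (rule Ck_on_SucI[OF has_derivative_const Ck_on_zero_UNIV])
qed simp

lemma Ck_on_add:
  assumes "Ck_on n UNIV f" "Ck_on n UNIV g"
  shows "Ck_on n UNIV (\<lambda>x. f x + g x)"
  using assms
proof (induction n arbitrary: f g)
  case 0
  then show ?case by (auto intro: continuous_on_add)
next
  case (Suc n)
  show ?case
  proof (rule Ck_on_SucI)
    show "((\<lambda>x. f x + g x) has_derivative
        (\<lambda>e. frechet_derivative f (at x) e + frechet_derivative g (at x) e)) (at x)" for x
      by (intro has_derivative_add Ck_on_has_derivative[OF Suc.prems(1)]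
          Ck_on_has_derivative[OF Suc.prems(2)])
  qed (use Suc in auto)
qed

lemma Ck_on_mult:
  assumes "Ck_on n UNIV f" "Ck_on n UNIV g"
  shows "Ck_on n UNIV (\<lambda>x. f x * g x)"
  using assms
proof (induction n arbitrary: f g)
  case 0
  then show ?case by (auto intro: continuous_on_mult)
next
  case (Suc n)
  show ?case
  proof (rule Ck_on_SucI)
    show "((\<lambda>x. f x * g x) has_derivative
        (\<lambda>e. f x * frechet_derivative g (at x) e + frechet_derivative f (at x) e * g x)) (at x)" for x
      by (intro has_derivative_mult Ck_on_has_derivative[OF Suc.prems(1)]
          Ck_on_has_derivative[OF Suc.prems(2)])
    show "Ck_on n UNIV (\<lambda>x. f x * frechet_derivative g (at x) b + frechet_derivative f (at x) b * g x)"
      if "b \<in> Basis" for b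
      by (intro Ck_on_add Suc.IH Ck_on_frechet_derivative that Suc.prems
          Ck_on_Suc_imp[OF Suc.prems(1)] Ck_on_Suc_imp[OF Suc.prems(2)])
  qed
qed

lemma Ck_on_prod:
  assumes "finite I" "\<And>i. i \<in> I \<Longrightarrow> Ck_on n UNIV (f i)"
  shows "Ck_on n UNIV (\<lambda>x. \<Prod>i\<in>I. f i x)"
  using assms by (induction I) (auto intro: Ck_on_mult Ck_on_const_UNIV)

text \<open>Closed under differentiation: the derivative of \<open>P(1/s) exp(-c/s)\<close> has the same shape.\<close>

definition flat :: "real \<Rightarrow> real poly \<Rightarrow> real \<Rightarrow> real" where
  "flat c P s = (if s > 0 then poly P (1 / s) * exp (- c / s) else 0)"

lemma poly_mult_exp_tendsto_0:
  fixes c :: real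
  assumes "c > 0"
  shows "((\<lambda>x. poly P x * exp (- c * x)) \<longlongrightarrow> 0) at_top"
proof -
  have lim: "filterlim (\<lambda>x. c * x) at_top at_top"
    by (rule filterlim_tendsto_pos_mult_at_top[OF tendsto_const assms filterlim_ident])
  have "((\<lambda>x. x ^ i * exp (- c * x)) \<longlongrightarrow> 0) at_top" for i
  proof -
    have "((\<lambda>x. (1 / c) ^ i * ((c * x) ^ i / exp (c * x))) \<longlongrightarrow> (1 / c) ^ i * 0) at_top"
      by (intro tendsto_mult tendsto_const filterlim_compose[OF tendsto_power_div_exp_0 lim])
    moreover have "(1 / c) ^ i * ((c * x) ^ i / exp (c * x)) = x ^ i * exp (- c * x)" for x
      using assms by (simp add: exp_minus power_mult_distrib field_simps)
    ultimately show ?thesis by simp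
  qed
  then have "((\<lambda>x. \<Sum>i\<le>degree P. coeff P i * (x ^ i * exp (- c * x))) \<longlongrightarrow>
      (\<Sum>i\<le>degree P. coeff P i * 0)) at_top"
    by (intro tendsto_sum tendsto_mult tendsto_const)
  then show ?thesis
    by (simp add: poly_altdef sum_distrib_right mult.assoc)
qed

text \<open>On the right of 0 the substitution x = 1/s turns the claim into exponential decay
  beating a polynomial at infinity; on the left the function is 0.\<close>

lemma flat_tendsto_0:
  assumes "c > 0"
  shows "(flat c P \<longlongrightarrow> 0) (at 0)"
proof (rule filterlim_split_at)
  show "(flat c P \<longlongrightarrow> 0) (at_left 0)"
    by (rule tendsto_eventually) (auto simp: flat_def eventually_at_filter)
  have "\<forall>\<^sub>F x in at_top. poly P x * exp (- c * x) = flat c P (inverse x)"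
    using eventually_gt_at_top[of 0]
    by eventually_elim (auto simp: flat_def field_simps)
  then show "(flat c P \<longlongrightarrow> 0) (at_right 0)"
    unfolding filterlim_at_right_to_top
    using poly_mult_exp_tendsto_0[OF assms, of P] by (rule Lim_transform_eventually[rotated])
qed

text \<open>For s > 0 the chain rule gives s^(-2) (c P - P')(1/s) exp(-c/s), and the factor s^(-2)
  is the \<open>monom 1 2\<close>. At s = 0 the difference quotient is again a flat function, so it
  tends to 0.\<close>

lemma flat_has_real_derivative:
  assumes "c > 0"
  shows "(flat c P has_real_derivative flat c (monom 1 2 * (smult c P - pderiv P)) s) (at s)"
proof -
  consider "s > 0" | "s < 0" | "s = 0" by linarith
  then show ?thesis
  proof cases
    case 1
    have "((\<lambda>s. poly P (1 / s) * exp (- c / s)) has_real_derivative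
        flat c (monom 1 2 * (smult c P - pderiv P)) s) (at s)"
      using 1 by (auto intro!: derivative_eq_intros DERIV_chain2[OF poly_DERIV]
          simp: flat_def poly_monom field_simps power2_eq_square)
    then show ?thesis
      by (rule has_field_derivative_transform_within_open[of _ _ _ "{0<..}"])
        (use 1 in \<open>auto simp: flat_def\<close>)
  next
    case 2
    have "((\<lambda>s. 0) has_real_derivative flat c (monom 1 2 * (smult c P - pderiv P)) s) (at s)"
      using 2 by (simp add: flat_def)
    then show ?thesis
      by (rule has_field_derivative_transform_within_open[of _ _ _ "{..<0}"])
        (use 2 in \<open>auto simp: flat_def\<close>)
  next
    case 3
    \<comment> \<open>Division by h multiplies P(1/h) by 1/h, that is, P by the indeterminate; for h
      <= 0 both sides are 0.\<close>
    have "(\<lambda>h. (flat c P (0 + h) - flat c P 0) / h) = flat c (pCons 0 P)"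
      by (auto simp: flat_def fun_eq_iff)
    then show ?thesis
      using flat_tendsto_0[OF assms, of "pCons 0 P"] 3
      by (simp add: DERIV_def flat_def)
  qed
qed

text \<open>The induction runs over all P at once, because a partial derivative is a constant times
  a flat function with a different polynomial.\<close>

lemma Ck_on_flat_inner:
  fixes b :: "'a::euclidean_space"
  assumes "c > 0"
  shows "Ck_on n UNIV (\<lambda>x. complex_of_real (flat c P (x \<bullet> b + a)))"
proof (induction n arbitrary: P)
  case 0
  have "isCont (flat c P) s" for s
    using flat_has_real_derivative[OF assms] DERIV_isCont by blast
  then have "continuous_on UNIV (flat c P)"
    by (simp add: continuous_at_imp_continuous_on)
  then show ?case
    by (auto intro!: continuous_intros continuous_on_compose2[of UNIV "flat c P"])
next
  case (Suc n)
  let ?P' = "monom 1 2 * (smult c P - pderiv P)"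
  show ?case
  proof (rule Ck_on_SucI)
    fix x :: 'a
    have "(flat c P has_derivative (\<lambda>h. flat c ?P' (x \<bullet> b + a) * h)) (at (x \<bullet> b + a))"
      using flat_has_real_derivative[OF assms] by (simp add: has_field_derivative_def)
    moreover have "((\<lambda>x. x \<bullet> b + a) has_derivative (\<lambda>e. e \<bullet> b)) (at x)"
      by (auto intro!: derivative_eq_intros)
    ultimately have "((\<lambda>x. flat c P (x \<bullet> b + a)) has_derivative (\<lambda>e. flat c ?P' (x \<bullet> b + a) * (e \<bullet> b))) (at x)"
      using has_derivative_compose by blast
    then show "((\<lambda>x. complex_of_real (flat c P (x \<bullet> b + a))) has_derivative
        (\<lambda>e. complex_of_real (flat c ?P' (x \<bullet> b + a)) * complex_of_real (e \<bullet> b))) (at x)"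
      by (auto dest!: has_derivative_of_real[where 'a=complex])
  qed (intro Ck_on_mult Suc.IH Ck_on_const_UNIV)
qed

text \<open>A product over coordinates of one-sided factors in x_b - l_b and u_b - x_b, written in
  the affine shape that \<open>Ck_on_flat_inner\<close> expects. Since exp(-c/s) tends to 1 as c
  tends to 0, small c approximates the indicator of the box without moving the support.\<close>

definition bump :: "real \<Rightarrow> 'a::euclidean_space \<Rightarrow> 'a \<Rightarrow> 'a \<Rightarrow> complex" where
  "bump c l u x = (\<Prod>b\<in>Basis. of_real (flat c 1 (x \<bullet> b + - (l \<bullet> b))) *
     of_real (flat c 1 (x \<bullet> (- b) + u \<bullet> b)))"

lemma flat_one: "flat c 1 s = (if s > 0 then exp (- c / s) else 0)"
  by (simp add: flat_def)

lemma bump_nonzero_iff: "bump c l u x \<noteq> 0 \<longleftrightarrow> x \<in> box l u"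
  by (auto simp: bump_def flat_one mem_box)

lemma bump_in_test_functions:
  assumes "c > 0" "cbox l u \<subseteq> U"
  shows "bump c l u \<in> test_functions U"
proof -
  have "{x. bump c l u x \<noteq> 0} = box l u"
    by (simp add: bump_nonzero_iff)
  moreover have "closure (box l u) \<subseteq> cbox l u"
    by (intro closure_minimal box_subset_cbox closed_cbox)
  moreover have "compact (closure (box l u))"
    by (simp add: bounded_box)
  moreover have "Ck_on n UNIV (bump c l u)" for n
    unfolding bump_def
    by (intro Ck_on_prod finite_Basis Ck_on_mult Ck_on_flat_inner assms)
  ultimately show ?thesis
    using assms by (auto simp: test_functions_def)
qed

lemma norm_bump_le_1:
  assumes "c \<ge> 0"
  shows "norm (bump c l u x) \<le> 1"
proof -
  have "norm (complex_of_real (flat c 1 s)) \<le> 1" for s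
    using assms by (auto simp: flat_one norm_of_real)
  then show ?thesis
    unfolding bump_def prod_norm[symmetric] norm_mult
    by (intro prod_le_1) (auto intro!: mult_le_one)
qed

lemma bump_tendsto_indicator:
  "(\<lambda>n. bump (1 / Suc n) l u x) \<longlonglongrightarrow> indicator (box l u) x"
proof (cases "x \<in> box l u")
  case True
  have lim: "(\<lambda>n. complex_of_real (flat (1 / Suc n) 1 s)) \<longlonglongrightarrow> 1" if "s > 0" for s
  proof -
    have "(\<lambda>n. exp (- (1 / Suc n) / s)) \<longlonglongrightarrow> exp (- 0 / s)"
      using that by (intro tendsto_intros LIMSEQ_Suc[OF lim_1_over_n]) auto
    then have "(\<lambda>n. flat (1 / Suc n) 1 s) \<longlonglongrightarrow> 1"
      using that by (simp add: flat_one)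
    then show ?thesis
      using tendsto_of_real by fastforce
  qed
  have "(\<lambda>n. bump (1 / Suc n) l u x) \<longlonglongrightarrow> (\<Prod>b\<in>(Basis::'a set). 1 * 1)"
    unfolding bump_def
    using True by (intro tendsto_prod tendsto_mult lim) (auto simp: mem_box)
  then show ?thesis
    using True by simp
next
  case False
  then have "bump (1 / Suc n) l u x = 0" for n
    using bump_nonzero_iff by blast
  then show ?thesis
    using False by simp
qed

section \<open>Fundamental lemma of the calculus of variations\<close>

lemma test_function_continuous:
  "\<phi> \<in> test_functions U \<Longrightarrow> continuous_on S \<phi>"
  unfolding test_functions_def
  by (auto intro: continuous_on_subset[OF Ck_on_imp_continuous_on])

text \<open>Bumps converge boundedly to the indicator of a box, so g has integral 0 over every
  closed box inside U. Lebesgue differentiation along shrinking cubes then forces g = 0 almost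
  everywhere.\<close>

lemma AE_eq_0_if_orthogonal_test_functions:
  fixes g :: "'a::euclidean_space \<Rightarrow> complex"
  assumes "open U" and int: "integrable (lebesgue_on U) g"
    and orth: "\<And>\<phi>. \<phi> \<in> test_functions U \<Longrightarrow> (LINT x|lebesgue_on U. g x * \<phi> x) = 0"
  shows "AE x in lebesgue_on U. g x = 0"
proof -
  have U: "U \<in> sets lebesgue" using \<open>open U\<close> by auto
  define G where "G x = (if x \<in> U then g x else 0)" for x
  have G: "integrable lebesgue G"
    using int Lebesgue_Measure.integrable_restrict_UNIV[OF U, of g] by (simp add: G_def[abs_def])
  have [measurable]: "g \<in> borel_measurable (lebesgue_on U)"
    using int by auto
  have box0: "integral (cbox l u) G = 0" if sub: "cbox l u \<subseteq> U" for l u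
  proof -
    let ?B = "indicator (box l u) :: 'a \<Rightarrow> complex"
    have [measurable]: "box l u \<in> sets (lebesgue_on U)"
      using U sub box_subset_cbox[of l u] by (subst sets_restrict_space_iff) auto
    have "(\<lambda>n. LINT x|lebesgue_on U. g x * bump (1 / Suc n) l u x) \<longlonglongrightarrow>
        (LINT x|lebesgue_on U. g x * ?B x)"
    proof (rule integral_dominated_convergence[where w = "\<lambda>x. norm (g x)"])
      show "(\<lambda>x. g x * bump (1 / Suc n) l u x) \<in> borel_measurable (lebesgue_on U)" for n
        by (intro borel_measurable_times[OF _ continuous_imp_measurable_on_sets_lebesgue] U
            test_function_continuous[OF bump_in_test_functions[OF _ sub]]) simp_all
      show "AE x in lebesgue_on U. norm (g x * bump (1 / Suc n) l u x) \<le> norm (g x)" for n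
        by (intro AE_I2) (simp add: norm_mult mult_left_le norm_bump_le_1)
      show "AE x in lebesgue_on U. (\<lambda>n. g x * bump (1 / Suc n) l u x) \<longlonglongrightarrow> g x * ?B x"
        by (intro AE_I2 tendsto_mult tendsto_const bump_tendsto_indicator)
      show "(\<lambda>x. g x * ?B x) \<in> borel_measurable (lebesgue_on U)"
        by measurable
    qed (use int in auto)
    moreover have "(LINT x|lebesgue_on U. g x * bump (1 / Suc n) l u x) = 0" for n
      by (intro orth bump_in_test_functions sub) simp
    ultimately have "(LINT x|lebesgue_on U. g x * ?B x) = 0"
      using LIMSEQ_unique[OF _ tendsto_const] by auto
    moreover have "integrable (lebesgue_on U) (\<lambda>x. g x * ?B x)"
      by (rule Bochner_Integration.integrable_bound[OF int]) (measurable, auto simp: indicator_def)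
    ultimately have "integral U (\<lambda>x. g x * ?B x) = 0"
      using lebesgue_integral_eq_integral U by metis
    moreover have "integral U (\<lambda>x. g x * ?B x) = integral UNIV (\<lambda>x. if x \<in> box l u then G x else 0)"
      unfolding integral_restrict_UNIV[of U, symmetric]
      by (rule arg_cong[where f = "integral UNIV"]) (auto simp: G_def indicator_def fun_eq_iff)
    ultimately show ?thesis
      by (simp add: integral_restrict_UNIV integral_open_interval)
  qed
  have "G absolutely_integrable_on UNIV"
    using G by (simp add: set_integrable_def)
  then have G_cbox: "G integrable_on cbox a b" for a b
    using integrable_on_subcbox[of G UNIV a b] set_lebesgue_integral_eq_integral(1) by blast
  \<comment> \<open>Lebesgue differentiation for cubes with lower corner x. It is stated on the
    whole space, which is why g was extended by 0 to \<open>G\<close>.\<close>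
  obtain N where N: "negligible N"
    and lim: "\<And>x e. \<lbrakk>x \<notin> N; 0 < e\<rbrakk> \<Longrightarrow> \<exists>d>0. \<forall>h. 0 < h \<and> h < d \<longrightarrow>
       norm (integral (cbox x (x + h *\<^sub>R One)) G /\<^sub>R h ^ DIM('a) - G x) < e"
    by (rule integrable_ccontinuous_explicit[OF G_cbox]) (rule that, assumption+)
  have "g x = 0" if "x \<in> U" "x \<notin> N" for x
  proof (rule ccontr)
    assume "g x \<noteq> 0"
    then have "0 < norm (g x)"
      by simp
    define D where "D h = norm (integral (cbox x (x + h *\<^sub>R One)) G /\<^sub>R h ^ DIM('a) - G x)" for h
    have "\<exists>d>0. \<forall>h. 0 < h \<and> h < d \<longrightarrow> D h < norm (g x)"
      unfolding D_def by (rule lim[OF \<open>x \<notin> N\<close> \<open>0 < norm (g x)\<close>])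
    then obtain d where d: "0 < d" "\<And>h. 0 < h \<Longrightarrow> h < d \<Longrightarrow> D h < norm (g x)"
      by blast
    obtain r where r: "r > 0" "ball x r \<subseteq> U"
      using \<open>open U\<close> \<open>x \<in> U\<close> open_contains_ball by blast
    \<comment> \<open>Points of the cube of side h at x have l1-distance at most
      \<open>h * DIM('a)\<close> from x, so this choice keeps the cube in the ball; the factors 2
      make both inequalities strict.\<close>
    define h where "h = min (d / 2) (r / (2 * DIM('a)))"
    have h: "0 < h" "h < d" "h * DIM('a) < r"
    proof -
      show "0 < h" "h < d" using d r by (auto simp: h_def)
      have "h * DIM('a) \<le> r / (2 * DIM('a)) * DIM('a)"
        by (intro mult_right_mono) (auto simp: h_def)
      also have "\<dots> < r" using r by simp
      finally show "h * DIM('a) < r" .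
    qed
    have "cbox x (x + h *\<^sub>R One) \<subseteq> ball x r"
    proof
      fix y assume y: "y \<in> cbox x (x + h *\<^sub>R One)"
      have "dist x y \<le> (\<Sum>b\<in>Basis. \<bar>(x - y) \<bullet> b\<bar>)"
        unfolding dist_norm by (rule norm_le_l1)
      also have "\<dots> \<le> (\<Sum>b\<in>(Basis::'a set). h)"
        using y by (intro sum_mono) (auto simp: mem_box inner_simps)
      also have "\<dots> < r" using h by (simp add: mult.commute)
      finally show "y \<in> ball x r" by simp
    qed
    then have "integral (cbox x (x + h *\<^sub>R One)) G = 0"
      using box0 r by blast
    then show False
      using d(2)[of h] h \<open>x \<in> U\<close> by (simp add: G_def D_def)
  qed
  then show ?thesis
    using N U by (intro AE_I'[of "N \<inter> U"])
      (auto simp: negligible_iff_null_sets null_sets_restrict_space intro: null_set_Int1 null_set_Int2)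
qed

section \<open>Fubini on Lebesgue-measurable cylinders\<close>

lemma lebesgue_measurable_ex_borel:
  fixes f :: "'a::euclidean_space \<Rightarrow> complex"
  assumes "f \<in> borel_measurable lebesgue"
  obtains f' where "f' \<in> borel_measurable borel" "AE x in lborel. f x = f' x"
proof -
  have "(\<lambda>x. Re (f x)) \<in> borel_measurable lebesgue" "(\<lambda>x. Im (f x)) \<in> borel_measurable lebesgue"
    using assms by auto
  then obtain r s where rs: "r \<in> borel_measurable lborel" "AE x in lborel. Re (f x) = r x"
      "s \<in> borel_measurable lborel" "AE x in lborel. Im (f x) = s x"
    using completion_ex_borel_measurable_real by metis
  show ?thesis
  proof
    show "(\<lambda>x. Complex (r x) (s x)) \<in> borel_measurable borel"
      using rs by (simp add: borel_measurable_complex_iff)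
    show "AE x in lborel. f x = Complex (r x) (s x)"
      using rs(2,4) by eventually_elim (simp add: complex_eq_iff)
  qed
qed

lemma AE_lborel_fst:
  assumes "AE x in (lborel :: 'a::euclidean_space measure). P x"
  shows "AE z in (lborel :: ('a \<times> 'b::euclidean_space) measure). P (fst z)"
proof -
  obtain N where N: "{x. \<not> P x} \<subseteq> N" "N \<in> null_sets (lborel :: 'a measure)"
    using assms by (auto simp: eventually_ae_filter)
  have "N \<times> (UNIV :: 'b set) \<in> null_sets (lborel \<Otimes>\<^sub>M lborel)"
    by (rule lborel.times_in_null_sets1[OF N(2)]) simp
  then show ?thesis
    using N by (intro AE_I'[of "N \<times> UNIV"]) (auto simp: lborel_prod)
qed

lemma indicator_scaleR_complex: "indicator S z *\<^sub>R w = indicator S z * (w :: complex)"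
  by (simp add: indicator_def)

lemma integral_lebesgue_on_eq_lborel:
  fixes f :: "'a::euclidean_space \<Rightarrow> complex"
  assumes "(\<lambda>x. indicator S x * f x) \<in> borel_measurable borel" "S \<in> sets lebesgue"
  shows "integral\<^sup>L (lebesgue_on S) f = (LINT x|lborel. indicator S x * f x)"
proof -
  have "integral\<^sup>L (lebesgue_on S) f = integral\<^sup>L lebesgue (\<lambda>x. indicator S x *\<^sub>R f x)"
    using assms by (intro integral_restrict_space) auto
  also have "\<dots> = integral\<^sup>L lebesgue (\<lambda>x. indicator S x * f x)"
    by (intro Bochner_Integration.integral_cong) (auto simp: indicator_def)
  finally show ?thesis
    using integral_completion[of _ lborel] assms by simp
qed

text \<open>Lebesgue measure on a product is only the completion of the product measure, so f is
  replaced by a Borel representative, Fubini is applied to the Borel function \<open>h\<close>, and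
  the result is carried back. Only f may be merely Lebesgue measurable; the kernel k is jointly
  Borel and bounded on the product.\<close>

lemma
  fixes f :: "'a::euclidean_space \<Rightarrow> complex" and k :: "'a \<times> 'b::euclidean_space \<Rightarrow> complex"
  assumes A: "A \<in> sets borel" and B: "B \<in> sets borel" "bounded B"
    and f: "integrable (lebesgue_on A) f"
    and k: "(\<lambda>z. indicator (A \<times> B) z * k z) \<in> borel_measurable borel"
    and C: "\<And>z. z \<in> A \<times> B \<Longrightarrow> norm (k z) \<le> C"
  shows integrable_times_lebesgue_on: "integrable (lebesgue_on (A \<times> B)) (\<lambda>z. f (fst z) * k z)"
    and integral_times_lebesgue_on_fst: "(LINT z|lebesgue_on (A \<times> B). f (fst z) * k z) =
      (LINT x|lebesgue_on A. f x * (LINT t|lebesgue_on B. k (x, t)))"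
    and integral_times_lebesgue_on_snd: "(LINT z|lebesgue_on (A \<times> B). f (fst z) * k z) =
      (LINT t|lebesgue_on B. LINT x|lebesgue_on A. f x * k (x, t))"
proof -
  note [measurable] = A B(1)
  have AB [measurable]: "A \<times> B \<in> sets borel"
    using A B by (simp add: borel_Times)
  have leb: "A \<in> sets lebesgue" "B \<in> sets lebesgue" "A \<times> B \<in> sets lebesgue"
    using A B AB by auto
  define F where "F x = indicator A x * f x" for x
  define K where "K z = indicator (A \<times> B) z * k z" for z
  have K [measurable]: "K \<in> borel_measurable borel"
    using k by (simp add: K_def[abs_def])
  have F: "integrable lebesgue F"
    using f leb by (simp add: integrable_restrict_space F_def[abs_def] indicator_scaleR_complex)
  obtain F' where F' [measurable]: "F' \<in> borel_measurable borel" and FF': "AE x in lborel. F x = F' x"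
    by (rule lebesgue_measurable_ex_borel[OF borel_measurable_integrable[OF F]])
  have FF'_leb: "AE x in lebesgue. F x = F' x"
    using FF' by (rule AE_completion)
  have F'_int: "integrable lborel F'"
  proof -
    have "integrable lebesgue F'"
      using F FF'_leb by (subst integrable_cong_AE[of F' lebesgue F]) (auto simp: measurable_completion eq_commute)
    then show ?thesis
      by (simp add: integrable_completion)
  qed
  \<comment> \<open>C may be negative when A x B is empty, and the bound below also has to hold at
    points outside A x B, where \<open>K\<close> is 0.\<close>
  define C' where "C' = max C 0"
  have KC: "norm (K z) \<le> C' * indicator B (snd z)" for z
    using C[of z] by (cases z) (auto simp: K_def C'_def indicator_def le_max_iff_disj)
  have intB: "integrable lborel (\<lambda>t. C' * indicator B t :: real)"
    using emeasure_bounded_finite[OF B(2)] B(1) by (intro integrable_mult_right) auto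
  define h where "h z = F' (fst z) * K z" for z
  have h_borel: "h \<in> borel_measurable borel"
    unfolding h_def
    by (intro borel_measurable_times measurable_compose[OF _ F'] K borel_measurable_continuous_onI
        continuous_intros)
  have h_meas [measurable]: "h \<in> borel_measurable (lborel \<Otimes>\<^sub>M lborel)"
    and [measurable]: "K \<in> borel_measurable (lborel \<Otimes>\<^sub>M lborel)"
    using h_borel K by (simp_all add: lborel_prod)
  have dom: "integrable (lborel \<Otimes>\<^sub>M lborel) (\<lambda>z. norm (F' (fst z)) * (C' * indicator B (snd z)))"
  proof (rule lborel_pair.Fubini_integrable)
    show "(\<lambda>z. norm (F' (fst z)) * (C' * indicator B (snd z))) \<in> borel_measurable (lborel \<Otimes>\<^sub>M lborel)"
      by measurable
    show "integrable lborel (\<lambda>x. LINT y|lborel.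
        norm (norm (F' (fst (x, y))) * (C' * indicator B (snd (x, y)))))"
      using F'_int by (simp add: abs_mult)
    show "AE x in lborel. integrable lborel
        (\<lambda>y. norm (F' (fst (x, y))) * (C' * indicator B (snd (x, y))))"
      using intB by simp
  qed
  have h_int: "integrable (lborel \<Otimes>\<^sub>M lborel) h"
    by (rule Bochner_Integration.integrable_bound[OF dom h_meas])
      (auto simp: h_def norm_mult C'_def intro!: AE_I2 mult_left_mono KC[unfolded C'_def])
  define H where "H z = indicator (A \<times> B) z * (f (fst z) * k z)" for z
  \<comment> \<open>f and its representative differ within a null set N, hence \<open>H\<close> and
    \<open>h\<close> differ only within N x UNIV.\<close>
  have "AE z in (lborel :: ('a \<times> 'b) measure). H z = h z"
    using AE_lborel_fst[OF FF']
    by eventually_elim (auto simp: h_def H_def F_def K_def indicator_def split: if_splits)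
  then have Hh: "AE z in lebesgue. h z = H z"
    by (intro AE_completion) auto
  have h_leb: "h \<in> borel_measurable lebesgue" "integrable lebesgue h"
    using h_int integrable_completion[of h lborel] h_meas
    by (auto simp: lborel_prod measurable_completion)
  have H_leb: "integrable lebesgue H" "integral\<^sup>L lebesgue H = integral\<^sup>L lebesgue h"
    using borel_measurable_AE[OF h_leb(1) Hh] Hh h_leb integrable_cong_AE[of h lebesgue H]
      integral_cong_AE[of h lebesgue H] by auto
  show "integrable (lebesgue_on (A \<times> B)) (\<lambda>z. f (fst z) * k z)"
    using H_leb(1) leb(3) by (simp add: integrable_restrict_space indicator_scaleR_complex H_def[abs_def])
  have "(LINT z|lebesgue_on (A \<times> B). f (fst z) * k z) = integral\<^sup>L lebesgue H"
    using leb(3) by (simp add: integral_restrict_space indicator_scaleR_complex H_def[abs_def])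
  also have "\<dots> = integral\<^sup>L lborel h"
    using H_leb(2) integral_completion[of h lborel] h_meas by (simp add: lborel_prod)
  finally have eq: "(LINT z|lebesgue_on (A \<times> B). f (fst z) * k z) = integral\<^sup>L (lborel \<Otimes>\<^sub>M lborel) h"
    by (simp add: lborel_prod)
  \<comment> \<open>Carries an x-integral from the representative back to f. It is applied with c an
    integral of \<open>K\<close> over t and with c a slice of \<open>K\<close> at fixed t.\<close>
  have F'_mult: "(LINT x|lborel. F' x * c x) = (LINT x|lebesgue_on A. f x * c x)"
    if [measurable]: "c \<in> borel_measurable borel" for c
  proof -
    have "(LINT x|lborel. F' x * c x) = (LINT x|lebesgue. F' x * c x)"
      by (rule integral_completion[symmetric]) measurable
    also have "\<dots> = (LINT x|lebesgue. F x * c x)"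
    proof (intro integral_cong_AE)
      show "(\<lambda>x. F' x * c x) \<in> borel_measurable lebesgue"
        by (intro measurable_completion) measurable
      show "(\<lambda>x. F x * c x) \<in> borel_measurable lebesgue"
        by (intro borel_measurable_times borel_measurable_integrable[OF F] measurable_completion) simp
      show "AE x in lebesgue. F' x * c x = F x * c x"
        using FF'_leb by eventually_elim simp
    qed
    also have "\<dots> = (LINT x|lebesgue_on A. f x * c x)"
      using leb(1) integral_restrict_space[of A lebesgue "\<lambda>x. f x * c x"]
      by (simp add: indicator_scaleR_complex F_def mult.assoc)
    finally show ?thesis .
  qed
  have "integral\<^sup>L (lborel \<Otimes>\<^sub>M lborel) h = (LINT x|lborel. LINT t|lborel. h (x, t))"
    using lborel_pair.integral_fst'[OF h_int] by simp
  also have "\<dots> = (LINT x|lborel. F' x * (LINT t|lborel. K (x, t)))"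
    by (simp add: h_def)
  also have "\<dots> = (LINT x|lebesgue_on A. f x * (LINT t|lborel. K (x, t)))"
    by (rule F'_mult) measurable
  also have "\<dots> = (LINT x|lebesgue_on A. f x * (LINT t|lebesgue_on B. k (x, t)))"
  proof (intro Bochner_Integration.integral_cong refl)
    fix x assume "x \<in> space (lebesgue_on A)"
    then have "x \<in> A" by simp
    then have K_eq: "K (x, t) = indicator B t * k (x, t)" for t
      by (simp add: K_def indicator_def)
    have "(\<lambda>t. K (x, t)) \<in> borel_measurable borel"
      by measurable
    then show "f x * (LINT t|lborel. K (x, t)) = f x * (LINT t|lebesgue_on B. k (x, t))"
      using integral_lebesgue_on_eq_lborel[of B "\<lambda>t. k (x, t)"] leb by (simp add: K_eq)
  qed
  finally show "(LINT z|lebesgue_on (A \<times> B). f (fst z) * k z) =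
      (LINT x|lebesgue_on A. f x * (LINT t|lebesgue_on B. k (x, t)))"
    using eq by simp
  have "integral\<^sup>L (lborel \<Otimes>\<^sub>M lborel) h = (LINT t|lborel. LINT x|lborel. h (x, t))"
    using lborel_pair.integral_snd[of "\<lambda>x t. h (x, t)"] h_int by simp
  also have "\<dots> = (LINT t|lborel. LINT x|lebesgue_on A. f x * K (x, t))"
    unfolding h_def fst_conv by (subst F'_mult) measurable
  also have "\<dots> = (LINT t|lborel. indicator B t * (LINT x|lebesgue_on A. f x * k (x, t)))"
  proof (intro Bochner_Integration.integral_cong refl)
    show "(LINT x|lebesgue_on A. f x * K (x, t)) = indicator B t * (LINT x|lebesgue_on A. f x * k (x, t))" for t
      by (cases "t \<in> B") (auto simp: K_def intro!: Bochner_Integration.integral_cong)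
  qed
  also have "\<dots> = (LINT t|lebesgue_on B. LINT x|lebesgue_on A. f x * k (x, t))"
  proof (rule integral_lebesgue_on_eq_lborel[symmetric])
    \<comment> \<open>Measurability in t of the inner integral is inherited from the Borel function
      \<open>h\<close>: the two inner integrals agree for every t, not just almost every t.\<close>
    have "(\<lambda>t. LINT x|lborel. h (x, t)) \<in> borel_measurable lborel"
      using lborel_pair.integrable_snd[of "\<lambda>x t. h (x, t)"] h_int by auto
    moreover have "(LINT x|lborel. h (x, t)) = indicator B t * (LINT x|lebesgue_on A. f x * k (x, t))" for t
      unfolding h_def fst_conv
      by (subst F'_mult, measurable, cases "t \<in> B")
        (auto simp: K_def intro!: Bochner_Integration.integral_cong)
    ultimately show "(\<lambda>t. indicator B t * (LINT x|lebesgue_on A. f x * k (x, t))) \<in> borel_measurable borel"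
      by simp
  qed (rule leb)
  finally show "(LINT z|lebesgue_on (A \<times> B). f (fst z) * k z) =
      (LINT t|lebesgue_on B. LINT x|lebesgue_on A. f x * k (x, t))"
    using eq by simp
qed

section \<open>Square-integrable functions and weak derivatives\<close>

lemma L2_measurable: "u \<in> L2 U \<Longrightarrow> u \<in> borel_measurable (lebesgue_on U)"
  and L2_integrable_square: "u \<in> L2 U \<Longrightarrow> integrable (lebesgue_on U) (\<lambda>x. (norm (u x))\<^sup>2)"
  by (auto simp: L2_def)

lemma norm_add_square_le: "(norm (a + b))\<^sup>2 \<le> 2 * (norm a)\<^sup>2 + 2 * (norm b)\<^sup>2"
proof -
  have "(norm (a + b))\<^sup>2 \<le> (norm a + norm b)\<^sup>2"
    by (intro power_mono norm_triangle_ineq) simp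
  also have "\<dots> \<le> 2 * (norm a)\<^sup>2 + 2 * (norm b)\<^sup>2"
    using sum_squares_ge_zero[of "norm a - norm b" 0] by (simp add: power2_eq_square algebra_simps)
  finally show ?thesis .
qed

lemma L2_add:
  assumes "u \<in> L2 U" "v \<in> L2 U"
  shows "(\<lambda>x. u x + v x) \<in> L2 U"
proof -
  note [measurable] = assms[THEN L2_measurable]
  have "integrable (lebesgue_on U) (\<lambda>x. 2 * (norm (u x))\<^sup>2 + 2 * (norm (v x))\<^sup>2)"
    by (intro Bochner_Integration.integrable_add integrable_mult_right L2_integrable_square assms)
  then have "integrable (lebesgue_on U) (\<lambda>x. (norm (u x + v x))\<^sup>2)"
    by (rule Bochner_Integration.integrable_bound) (auto simp: norm_add_square_le)
  then show ?thesis by (simp add: L2_def)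
qed

lemma L2_cmult:
  assumes "u \<in> L2 U"
  shows "(\<lambda>x. c * u x) \<in> L2 U"
  using assms by (auto simp: L2_def norm_mult power_mult_distrib)

lemma L2_sum:
  assumes "\<And>i. i \<in> I \<Longrightarrow> u i \<in> L2 U"
  shows "(\<lambda>x. \<Sum>i\<in>I. c i * u i x) \<in> L2 U"
  using assms
proof (induction I rule: infinite_finite_induct)
  case (insert i I)
  then show ?case by (simp add: L2_add L2_cmult)
qed (simp_all add: L2_def)

lemma L2_integrable_mult_cnj:
  assumes "u \<in> L2 U" "v \<in> L2 U"
  shows "integrable (lebesgue_on U) (\<lambda>x. u x * cnj (v x))"
proof -
  note [measurable] = assms[THEN L2_measurable]
  have "integrable (lebesgue_on U) (\<lambda>x. (norm (u x))\<^sup>2 + (norm (v x))\<^sup>2)"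
    by (intro Bochner_Integration.integrable_add L2_integrable_square assms)
  then show ?thesis
  proof (rule Bochner_Integration.integrable_bound)
    have "a * b \<le> a\<^sup>2 + b\<^sup>2" if "a \<ge> 0" "b \<ge> 0" for a b :: real
      using sum_squares_bound[of a b] mult_nonneg_nonneg[OF that] by linarith
    then show "AE x in lebesgue_on U. norm (u x * cnj (v x)) \<le> norm ((norm (u x))\<^sup>2 + (norm (v x))\<^sup>2)"
      by (simp add: norm_mult)
    have [measurable]: "(\<lambda>x. cnj (v x)) \<in> borel_measurable (lebesgue_on U)"
      by (rule measurable_compose[OF _ borel_measurable_continuous_onI]) (auto intro!: continuous_intros)
    show "(\<lambda>x. u x * cnj (v x)) \<in> borel_measurable (lebesgue_on U)"
      by measurable
  qed
qed

text \<open>On a set of finite measure, dominate |u| by |u|^2 + 1.\<close>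

lemma L2_imp_integrable:
  assumes "u \<in> L2 U" "U \<in> lmeasurable"
  shows "integrable (lebesgue_on U) u"
proof -
  have "integrable (lebesgue_on U) (\<lambda>x. (norm (u x))\<^sup>2 + 1)"
    using assms by (intro Bochner_Integration.integrable_add L2_integrable_square)
      (auto intro!: finite_measure.integrable_const finite_measure_lebesgue_on)
  then show ?thesis
  proof (rule Bochner_Integration.integrable_bound)
    have "a \<le> a\<^sup>2 + 1" for a :: real
      using sum_squares_bound[of a 1] by (simp add: power2_eq_square) (smt (verit) zero_le_square)
    then show "AE x in lebesgue_on U. norm (u x) \<le> norm ((norm (u x))\<^sup>2 + 1)"
      by simp
  qed (rule L2_measurable[OF assms(1)])
qed

lemma integrable_mult_continuous:
  fixes u k :: "'a::euclidean_space \<Rightarrow> complex"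
  assumes "integrable (lebesgue_on U) u" "bounded U" "U \<in> sets lebesgue" "continuous_on UNIV k"
  shows "integrable (lebesgue_on U) (\<lambda>x. u x * k x)"
proof -
  have "compact (k ` closure U)"
    using assms by (intro compact_continuous_image continuous_on_subset[OF assms(4)]) auto
  then obtain C where C: "\<And>x. x \<in> U \<Longrightarrow> norm (k x) \<le> C"
    using compact_imp_bounded bounded_iff closure_subset by (metis image_eqI subsetD)
  have "integrable (lebesgue_on U) (\<lambda>x. C * norm (u x))"
    using assms(1) by auto
  then show ?thesis
  proof (rule Bochner_Integration.integrable_bound)
    have "k \<in> borel_measurable (lebesgue_on U)"
      using assms by (intro continuous_imp_measurable_on_sets_lebesgue continuous_on_subset[OF assms(4)]) auto
    then show "(\<lambda>x. u x * k x) \<in> borel_measurable (lebesgue_on U)"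
      using assms(1) by (intro borel_measurable_times) auto
    show "AE x in lebesgue_on U. norm (u x * k x) \<le> norm (C * norm (u x))"
    proof (rule AE_I2)
      fix x assume "x \<in> space (lebesgue_on U)"
      then have "norm (k x) \<le> C" using C by simp
      then show "norm (u x * k x) \<le> norm (C * norm (u x))"
        by (simp add: norm_mult mult.commute) (smt (verit) mult_right_mono norm_ge_zero abs_ge_self)
    qed
  qed
qed

lemma test_function_has_derivative:
  assumes "\<phi> \<in> test_functions U"
  shows "(\<phi> has_derivative frechet_derivative \<phi> (at x)) (at x)"
  using assms Ck_on_has_derivative unfolding test_functions_def by blast

lemma test_function_deriv_continuous:
  assumes "\<phi> \<in> test_functions U" "e \<in> Basis"
  shows "continuous_on UNIV (\<lambda>x. frechet_derivative \<phi> (at x) e)"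
proof -
  have "Ck_on (Suc 0) UNIV \<phi>"
    using assms(1) unfolding test_functions_def by blast
  from Ck_on_frechet_derivative[OF this assms(2)] show ?thesis by simp
qed

text \<open>Both candidates have the same integral against every test function, so the fundamental
  lemma applies to their difference.\<close>

lemma AE_eq_of_has_weak_deriv:
  assumes U: "open U" "bounded U" and g: "g \<in> L2 U" "h \<in> L2 U"
    and wd: "has_weak_deriv U e u g" "has_weak_deriv U e u h"
  shows "AE x in lebesgue_on U. g x = h x"
proof -
  have U': "U \<in> lmeasurable" "U \<in> sets lebesgue"
    using U by (auto intro: lmeasurable_open)
  note int = L2_imp_integrable[OF _ U'(1)]
  have "AE x in lebesgue_on U. g x - h x = 0"
  proof (rule AE_eq_0_if_orthogonal_test_functions[OF U(1)])
    show "integrable (lebesgue_on U) (\<lambda>x. g x - h x)"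
      by (intro Bochner_Integration.integrable_diff int g)
    fix \<phi> assume \<phi>: "\<phi> \<in> test_functions U"
    note int' = integrable_mult_continuous[OF int U(2) U'(2) test_function_continuous[OF \<phi>]]
    have "(LINT x|lebesgue_on U. g x * \<phi> x) = (LINT x|lebesgue_on U. h x * \<phi> x)"
      using wd \<phi> unfolding has_weak_deriv_def by (metis neg_equal_iff_equal)
    then show "(LINT x|lebesgue_on U. (g x - h x) * \<phi> x) = 0"
      using int'[OF g(1)] int'[OF g(2)] by (simp add: left_diff_distrib)
  qed
  then show ?thesis by simp
qed

text \<open>Exhibiting one square-integrable weak derivative g shows that the choice in
  \<open>weak_deriv\<close> is genuine, and uniqueness then computes it almost everywhere.\<close>

lemma
  assumes "open U" "bounded U" "g \<in> L2 U" "has_weak_deriv U e u g"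
  shows weak_deriv_L2: "weak_deriv U e u \<in> L2 U"
    and has_weak_deriv_weak_deriv: "has_weak_deriv U e u (weak_deriv U e u)"
    and AE_weak_deriv_eq: "AE x in lebesgue_on U. weak_deriv U e u x = g x"
proof -
  have *: "weak_deriv U e u \<in> L2 U \<and> has_weak_deriv U e u (weak_deriv U e u)"
    unfolding weak_deriv_def by (rule someI[of _ g]) (use assms in blast)
  then show "weak_deriv U e u \<in> L2 U" "has_weak_deriv U e u (weak_deriv U e u)" by auto
  show "AE x in lebesgue_on U. weak_deriv U e u x = g x"
    using AE_eq_of_has_weak_deriv[OF assms(1,2) _ assms(3) _ assms(4)] * by blast
qed

text \<open>Splitting the integrals needs each summand integrable. This comes from boundedness of U
  and continuity of the derivative of the test function, which \<open>Ck_on\<close> provides along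
  basis directions.\<close>

lemma has_weak_deriv_sum:
  assumes U: "open U" "bounded U" and e: "e \<in> Basis"
    and u: "\<And>i. i \<in> I \<Longrightarrow> u i \<in> L2 U" and g: "\<And>i. i \<in> I \<Longrightarrow> g i \<in> L2 U"
    and wd: "\<And>i. i \<in> I \<Longrightarrow> has_weak_deriv U e (u i) (g i)"
  shows "has_weak_deriv U e (\<lambda>x. \<Sum>i\<in>I. c i * u i x) (\<lambda>x. \<Sum>i\<in>I. c i * g i x)"
  unfolding has_weak_deriv_def
proof
  fix \<phi> assume \<phi>: "\<phi> \<in> test_functions U"
  have U': "U \<in> lmeasurable" "U \<in> sets lebesgue"
    using U by (auto intro: lmeasurable_open)
  note int = integrable_mult_continuous[OF L2_imp_integrable[OF _ U'(1)] U(2) U'(2)]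
  note int' = int[OF u test_function_deriv_continuous[OF \<phi> e]] int[OF g test_function_continuous[OF \<phi>]]
  have "(LINT x|lebesgue_on U. (\<Sum>i\<in>I. c i * u i x) * frechet_derivative \<phi> (at x) e) =
      (\<Sum>i\<in>I. c i * (LINT x|lebesgue_on U. u i x * frechet_derivative \<phi> (at x) e))"
    using int'(1) by (simp add: sum_distrib_right mult.assoc Bochner_Integration.integral_sum)
  also have "\<dots> = (\<Sum>i\<in>I. c i * - (LINT x|lebesgue_on U. g i x * \<phi> x))"
    using wd \<phi> by (simp add: has_weak_deriv_def)
  also have "\<dots> = - (LINT x|lebesgue_on U. (\<Sum>i\<in>I. c i * g i x) * \<phi> x)"
    using int'(2) by (simp add: sum_distrib_right mult.assoc Bochner_Integration.integral_sum sum_negf)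
  finally show "(LINT x|lebesgue_on U. (\<Sum>i\<in>I. c i * u i x) * frechet_derivative \<phi> (at x) e) =
      - (LINT x|lebesgue_on U. (\<Sum>i\<in>I. c i * g i x) * \<phi> x)" .
qed

section \<open>Tensor products\<close>

text \<open>Bounded rather than square-integrable, so that products such as v * cnj w stay in the
  class; Borel rather than Lebesgue, as the kernel in the Fubini lemmas has to be. The indicator
  leaves values outside I free.\<close>

definition bdd_borel_on :: "real set \<Rightarrow> (real \<Rightarrow> complex) \<Rightarrow> bool" where
  "bdd_borel_on I v \<longleftrightarrow>
     (\<lambda>t. indicator I t * v t) \<in> borel_measurable borel \<and> (\<exists>C. \<forall>t\<in>I. norm (v t) \<le> C)"

lemma bdd_borel_on_measurable:
  "bdd_borel_on I v \<Longrightarrow> (\<lambda>t. indicator I t * v t) \<in> borel_measurable borel"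
  by (simp add: bdd_borel_on_def)

lemma bdd_borel_on_bound:
  assumes "bdd_borel_on I v"
  obtains C where "C \<ge> 0" "\<And>t. t \<in> I \<Longrightarrow> norm (v t) \<le> C"
proof -
  obtain C where C: "\<forall>t\<in>I. norm (v t) \<le> C"
    using assms by (auto simp: bdd_borel_on_def)
  show ?thesis
    by (rule that[of "max C 0"]) (use C in \<open>auto simp: le_max_iff_disj\<close>)
qed

lemma bdd_borel_on_mult:
  assumes "bdd_borel_on I v" "bdd_borel_on I w"
  shows "bdd_borel_on I (\<lambda>t. v t * w t)"
proof -
  have "(\<lambda>t. (indicator I t * v t) * (indicator I t * w t)) \<in> borel_measurable borel"
    by (intro borel_measurable_times bdd_borel_on_measurable assms)
  moreover have "(\<lambda>t. (indicator I t * v t) * (indicator I t * w t)) = (\<lambda>t. indicator I t * (v t * w t))"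
    by (auto simp: indicator_def)
  moreover obtain C where C: "C \<ge> 0" "\<And>t. t \<in> I \<Longrightarrow> norm (v t) \<le> C"
    by (rule bdd_borel_on_bound[OF assms(1)]) (rule that)
  moreover obtain D where D: "D \<ge> 0" "\<And>t. t \<in> I \<Longrightarrow> norm (w t) \<le> D"
    by (rule bdd_borel_on_bound[OF assms(2)]) (rule that)
  ultimately show ?thesis
    by (auto simp: bdd_borel_on_def norm_mult intro!: exI[of _ "C * D"] mult_mono)
qed

lemma bdd_borel_on_add:
  assumes "bdd_borel_on I v" "bdd_borel_on I w"
  shows "bdd_borel_on I (\<lambda>t. v t + w t)"
proof -
  have "(\<lambda>t. (indicator I t * v t) + (indicator I t * w t)) \<in> borel_measurable borel"
    by (intro borel_measurable_add bdd_borel_on_measurable assms)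
  moreover obtain C where C: "C \<ge> 0" "\<And>t. t \<in> I \<Longrightarrow> norm (v t) \<le> C"
    by (rule bdd_borel_on_bound[OF assms(1)]) (rule that)
  moreover obtain D where D: "D \<ge> 0" "\<And>t. t \<in> I \<Longrightarrow> norm (w t) \<le> D"
    by (rule bdd_borel_on_bound[OF assms(2)]) (rule that)
  ultimately show ?thesis
    by (auto simp: bdd_borel_on_def algebra_simps intro!: exI[of _ "C + D"] norm_triangle_le add_mono)
qed

lemma bdd_borel_on_cnj:
  assumes "bdd_borel_on I v"
  shows "bdd_borel_on I (\<lambda>t. cnj (v t))"
proof -
  have "(\<lambda>t. cnj (indicator I t * v t)) \<in> borel_measurable borel"
    by (rule measurable_compose[OF bdd_borel_on_measurable[OF assms] borel_measurable_continuous_onI])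
      (intro continuous_intros)
  moreover have "(\<lambda>t. cnj (indicator I t * v t)) = (\<lambda>t. indicator I t * cnj (v t))"
    by (auto simp: indicator_def)
  ultimately show ?thesis
    using assms by (auto simp: bdd_borel_on_def)
qed

lemma bdd_borel_on_continuous:
  assumes "continuous_on UNIV v" "bounded I" "I \<in> sets borel"
  shows "bdd_borel_on I v"
proof -
  have "compact (v ` closure I)"
    using assms by (intro compact_continuous_image continuous_on_subset[OF assms(1)]) auto
  then obtain C where "\<And>t. t \<in> I \<Longrightarrow> norm (v t) \<le> C"
    using compact_imp_bounded bounded_iff closure_subset by (metis image_eqI subsetD)
  then show ?thesis
    using assms borel_measurable_times[OF borel_measurable_indicator[OF assms(3)]
        borel_measurable_continuous_onI[OF assms(1)]]
    by (auto simp: bdd_borel_on_def)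
qed

lemma bdd_borel_on_integrable:
  assumes "bdd_borel_on I v" "bounded I" "I \<in> sets borel"
  shows "integrable (lebesgue_on I) v"
proof -
  have I: "I \<in> lmeasurable"
    using assms by (auto simp: bounded_set_imp_lmeasurable)
  obtain C where C: "C \<ge> 0" "\<And>t. t \<in> I \<Longrightarrow> norm (v t) \<le> C"
    by (rule bdd_borel_on_bound[OF assms(1)]) (rule that)
  have "(\<lambda>t. indicator I t * v t) \<in> borel_measurable lebesgue"
    by (intro measurable_completion) (simp add: bdd_borel_on_measurable[OF assms(1)])
  then have "v \<in> borel_measurable (lebesgue_on I)"
    using I by (subst borel_measurable_restrict_space_iff) (auto simp: indicator_scaleR_complex)
  moreover have "integrable (lebesgue_on I) (\<lambda>t. C)"
    by (intro finite_measure.integrable_const finite_measure_lebesgue_on I)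
  ultimately show ?thesis
    using C by (intro Bochner_Integration.integrable_bound[of "lebesgue_on I" "\<lambda>t. C" v]) auto
qed

text \<open>The two conclusions are the hypotheses on the kernel in the Fubini lemmas.\<close>

lemma bdd_borel_on_times_continuous:
  fixes A :: "'a::euclidean_space set" and k :: "'a \<times> real \<Rightarrow> complex"
  assumes v: "bdd_borel_on I v" and k: "continuous_on UNIV k"
    and A: "bounded A" "A \<in> sets borel" and I: "bounded I" "I \<in> sets borel"
  shows "(\<lambda>z. indicator (A \<times> I) z * (v (snd z) * k z)) \<in> borel_measurable borel" (is ?meas)
    and "\<exists>C. \<forall>z\<in>A \<times> I. norm (v (snd z) * k z) \<le> C" (is ?bdd)
proof -
  have "(\<lambda>z. indicator (A \<times> I) z * k z * (indicator I (snd z) * v (snd z))) \<in> borel_measurable borel"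
    using A I borel_measurable_continuous_onI[OF k]
    by (intro borel_measurable_times measurable_compose[OF _ bdd_borel_on_measurable[OF v]]
        borel_measurable_indicator borel_Times) (auto intro!: borel_measurable_continuous_onI continuous_intros)
  moreover have "(\<lambda>z. indicator (A \<times> I) z * k z * (indicator I (snd z) * v (snd z))) =
      (\<lambda>z. indicator (A \<times> I) z * (v (snd z) * k z))"
    by (auto simp: indicator_def)
  ultimately show ?meas by simp
  obtain C where C: "C \<ge> 0" "\<And>t. t \<in> I \<Longrightarrow> norm (v t) \<le> C"
    by (rule bdd_borel_on_bound[OF v]) (rule that)
  have "compact (k ` closure (A \<times> I))"
    using A I by (intro compact_continuous_image continuous_on_subset[OF k])
      (auto simp: bounded_Times)
  then obtain D where D: "\<And>z. z \<in> A \<times> I \<Longrightarrow> norm (k z) \<le> D"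
    using compact_imp_bounded bounded_iff closure_subset by (metis image_eqI subsetD)
  show ?bdd
    by (intro exI[of _ "C * D"] ballI) (auto simp: norm_mult intro!: mult_mono C D)
qed

lemma
  fixes A :: "'a::euclidean_space set"
  assumes f: "integrable (lebesgue_on A) f" and c: "bdd_borel_on I c"
    and A: "bounded A" "A \<in> sets borel" and I: "bounded I" "I \<in> sets borel"
  shows integrable_tensor: "integrable (lebesgue_on (A \<times> I)) (\<lambda>z. f (fst z) * c (snd z))"
    and integral_tensor: "(LINT z|lebesgue_on (A \<times> I). f (fst z) * c (snd z)) =
      (LINT x|lebesgue_on A. f x) * (LINT t|lebesgue_on I. c t)"
proof -
  note k = bdd_borel_on_times_continuous[OF c continuous_on_const[of _ 1] A I, unfolded mult_1_right]
  obtain C where C: "\<And>z. z \<in> A \<times> I \<Longrightarrow> norm (c (snd z)) \<le> C"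
    using k(2) by blast
  show "integrable (lebesgue_on (A \<times> I)) (\<lambda>z. f (fst z) * c (snd z))"
    by (rule integrable_times_lebesgue_on[OF A(2) I(2,1) f k(1) C])
  show "(LINT z|lebesgue_on (A \<times> I). f (fst z) * c (snd z)) =
      (LINT x|lebesgue_on A. f x) * (LINT t|lebesgue_on I. c t)"
    using integral_times_lebesgue_on_fst[OF A(2) I(2,1) f k(1) C] by simp
qed

lemma L2_tensor:
  fixes A :: "'a::euclidean_space set"
  assumes f: "f \<in> L2 A" and v: "bdd_borel_on I v"
    and A: "bounded A" "A \<in> sets borel" and I: "bounded I" "I \<in> sets borel"
  shows "(\<lambda>z. v (snd z) * f (fst z)) \<in> L2 (A \<times> I)"
proof -
  have "A \<in> lmeasurable"
    using A by (auto simp: bounded_set_imp_lmeasurable)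
  \<comment> \<open>This supplies the measurability half of \<open>L2\<close>; the
    square-integrability half is the norm of the integrand that follows.\<close>
  then have "integrable (lebesgue_on (A \<times> I)) (\<lambda>z. f (fst z) * v (snd z))"
    by (intro integrable_tensor L2_imp_integrable f v A I)
  moreover have "integrable (lebesgue_on (A \<times> I))
      (\<lambda>z. (f (fst z) * cnj (f (fst z))) * (v (snd z) * cnj (v (snd z))))"
    by (rule integrable_tensor[OF L2_integrable_mult_cnj[OF f f]
        bdd_borel_on_mult[OF v bdd_borel_on_cnj[OF v]] A I])
  then have "integrable (lebesgue_on (A \<times> I))
      (\<lambda>z. norm ((f (fst z) * cnj (f (fst z))) * (v (snd z) * cnj (v (snd z)))))"
    by (rule integrable_norm)
  ultimately show ?thesis
    by (simp add: L2_def norm_mult power2_eq_square ac_simps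
        borel_measurable_integrable)
qed

lemma test_function_slice:
  fixes A :: "'a::euclidean_space set" and I :: "real set"
  assumes \<phi>: "\<phi> \<in> test_functions (A \<times> I)"
  shows "(\<lambda>x. \<phi> (x, t)) \<in> test_functions A"
    and "frechet_derivative (\<lambda>x. \<phi> (x, t)) (at x) e = frechet_derivative \<phi> (at (x, t)) (e, 0)"
proof -
  have slice: "((\<lambda>x. f (x, t)) has_derivative (\<lambda>e. f' (e, 0))) (at x)"
    if "(f has_derivative f') (at (x, t))" for f :: "'a \<times> real \<Rightarrow> complex" and f' x
  proof -
    have "((\<lambda>x. (x, t)) has_derivative (\<lambda>e. (e, 0))) (at x)"
      by (auto intro!: derivative_eq_intros)
    from has_derivative_compose[OF this] that show ?thesis by blast
  qed
  show "frechet_derivative (\<lambda>x. \<phi> (x, t)) (at x) e = frechet_derivative \<phi> (at (x, t)) (e, 0)"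
    using frechet_derivative_at[OF slice[OF test_function_has_derivative[OF \<phi>]]] by metis
  have ck: "Ck_on n UNIV (\<lambda>x. f (x, t))" if "Ck_on n UNIV f" for n and f :: "'a \<times> real \<Rightarrow> complex"
    using that
  proof (induction n arbitrary: f)
    case 0
    then show ?case
      by (auto intro!: continuous_on_compose2[of UNIV f] continuous_intros)
  next
    case (Suc n)
    show ?case
    proof (rule Ck_on_SucI)
      show "((\<lambda>x. f (x, t)) has_derivative (\<lambda>e. frechet_derivative f (at (x, t)) (e, 0))) (at x)" for x
        by (rule slice[OF Ck_on_has_derivative[OF Suc.prems]])
      show "Ck_on n UNIV (\<lambda>x. frechet_derivative f (at (x, t)) (b, 0))" if "b \<in> Basis" for b
        using that by (intro Suc.IH Ck_on_frechet_derivative[OF Suc.prems]) (auto simp: Basis_prod_def)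
    qed
  qed
  define K where "K = closure {z. \<phi> z \<noteq> 0}"
  have K: "compact K" "K \<subseteq> A \<times> I"
    using \<phi> by (auto simp: test_functions_def K_def)
  \<comment> \<open>The support of a slice may be smaller than the slice of the support. The
    inclusion suffices: the right side is closed and lies in the projection of the compact set
    \<open>K\<close>.\<close>
  have sub: "closure {x. \<phi> (x, t) \<noteq> 0} \<subseteq> (\<lambda>x. (x, t)) -` K"
  proof (rule closure_minimal)
    show "{x. \<phi> (x, t) \<noteq> 0} \<subseteq> (\<lambda>x. (x, t)) -` K"
      using closure_subset[of "{z. \<phi> z \<noteq> 0}"] by (auto simp: K_def)
    show "closed ((\<lambda>x. (x, t)) -` K)"
      using K by (intro closed_vimage compact_imp_closed continuous_intros)
  qed
  then have "closure {x. \<phi> (x, t) \<noteq> 0} \<subseteq> fst ` K"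
    by force
  moreover have "bounded (fst ` K)"
    using K by (intro bounded_fst compact_imp_bounded)
  ultimately have "compact (closure {x. \<phi> (x, t) \<noteq> 0})"
    using bounded_subset by (auto simp: compact_eq_bounded_closed)
  moreover have "closure {x. \<phi> (x, t) \<noteq> 0} \<subseteq> A"
    using sub K(2) by auto
  ultimately show "(\<lambda>x. \<phi> (x, t)) \<in> test_functions A"
    using \<phi> ck by (auto simp: test_functions_def)
qed

text \<open>With t as the outer variable, every slice of a test function is a test function on A, so
  the weak derivative of f acts slice by slice while v is a factor that does not depend on
  x.\<close>

lemma has_weak_deriv_tensor_space:
  fixes A :: "'a::euclidean_space set"
  assumes f: "f \<in> L2 A" and g: "g \<in> L2 A" and wd: "has_weak_deriv A e f g" and e: "e \<in> Basis"
    and v: "bdd_borel_on I v"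
    and A: "bounded A" "A \<in> sets borel" and I: "bounded I" "I \<in> sets borel"
  shows "has_weak_deriv (A \<times> I) (e, 0) (\<lambda>z. v (snd z) * f (fst z)) (\<lambda>z. v (snd z) * g (fst z))"
  unfolding has_weak_deriv_def
proof
  fix \<phi> assume \<phi>: "\<phi> \<in> test_functions (A \<times> I)"
  have A': "A \<in> lmeasurable"
    using A by (auto simp: bounded_set_imp_lmeasurable)
  have Fub: "(LINT z|lebesgue_on (A \<times> I). v (snd z) * h (fst z) * k z) =
      (LINT t|lebesgue_on I. v t * (LINT x|lebesgue_on A. h x * k (x, t)))"
    if h: "h \<in> L2 A" and k: "continuous_on UNIV k" for h :: "'a \<Rightarrow> complex" and k
  proof -
    note K = bdd_borel_on_times_continuous[OF v k A I]
    obtain C where C: "\<And>z. z \<in> A \<times> I \<Longrightarrow> norm (v (snd z) * k z) \<le> C"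
      using K(2) by blast
    have "(LINT z|lebesgue_on (A \<times> I). h (fst z) * (v (snd z) * k z)) =
        (LINT t|lebesgue_on I. LINT x|lebesgue_on A. h x * (v t * k (x, t)))"
      using integral_times_lebesgue_on_snd[OF A(2) I(2,1) L2_imp_integrable[OF h A'] K(1) C] by simp
    then show ?thesis
      by (simp add: mult.left_commute[of "h _"] mult.assoc)
  qed
  have e': "(e, 0) \<in> Basis" using e by (auto simp: Basis_prod_def)
  have "(LINT x|lebesgue_on A. f x * frechet_derivative \<phi> (at (x, t)) (e, 0)) =
      - (LINT x|lebesgue_on A. g x * \<phi> (x, t))" for t
    using bspec[OF wd[unfolded has_weak_deriv_def] test_function_slice(1)[OF \<phi>, of t]]
    by (simp add: test_function_slice(2)[OF \<phi>])
  then show "(LINT z|lebesgue_on (A \<times> I). v (snd z) * f (fst z) * frechet_derivative \<phi> (at z) (e, 0)) =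
      - (LINT z|lebesgue_on (A \<times> I). v (snd z) * g (fst z) * \<phi> z)"
    by (simp add: Fub[OF f test_function_deriv_continuous[OF \<phi> e']] Fub[OF g test_function_continuous[OF \<phi>]])
qed

section \<open>Piecewise differentiability in time and splines\<close>

text \<open>The class in which the fundamental theorem of calculus tolerates nodes: v is continuous
  up to both ends, and \<open>v'\<close> need not be its derivative at finitely many points. It is
  closed under products and conjugation and contains the restrictions of test functions to time
  lines.\<close>

definition pw_deriv :: "real \<Rightarrow> (real \<Rightarrow> complex) \<Rightarrow> (real \<Rightarrow> complex) \<Rightarrow> bool" where
  "pw_deriv T v v' \<longleftrightarrow> bdd_borel_on {0<..<T} v \<and> bdd_borel_on {0<..<T} v' \<and>
     continuous_on {0..T} v \<and>
     (\<exists>S. finite S \<and> (\<forall>t\<in>{0<..<T} - S. (v has_vector_derivative v' t) (at t)))"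

lemma pw_deriv_const: "pw_deriv T (\<lambda>t. c) (\<lambda>t. 0)"
  by (auto simp: pw_deriv_def intro!: bdd_borel_on_continuous exI[of _ "{}"])

lemma pw_deriv_mult:
  assumes "pw_deriv T v v'" "pw_deriv T w w'"
  shows "pw_deriv T (\<lambda>t. v t * w t) (\<lambda>t. v t * w' t + v' t * w t)"
proof -
  obtain S R where S: "finite S" "\<And>t. t \<in> {0<..<T} - S \<Longrightarrow> (v has_vector_derivative v' t) (at t)"
    and R: "finite R" "\<And>t. t \<in> {0<..<T} - R \<Longrightarrow> (w has_vector_derivative w' t) (at t)"
    using assms unfolding pw_deriv_def by blast
  have "((\<lambda>t. v t * w t) has_vector_derivative v t * w' t + v' t * w t) (at t)"
    if "t \<in> {0<..<T} - (S \<union> R)" for t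
    using that by (intro has_vector_derivative_mult S R) auto
  moreover have "finite (S \<union> R)" using S R by simp
  ultimately show ?thesis
    using assms unfolding pw_deriv_def
    by (intro conjI bdd_borel_on_add bdd_borel_on_mult continuous_on_mult exI[of _ "S \<union> R"]) auto
qed

lemma pw_deriv_cnj:
  assumes "pw_deriv T v v'"
  shows "pw_deriv T (\<lambda>t. cnj (v t)) (\<lambda>t. cnj (v' t))"
  using assms by (auto simp: pw_deriv_def
      intro!: bdd_borel_on_cnj continuous_intros has_vector_derivative_cnj)

lemma pw_deriv_integral:
  assumes "pw_deriv T v v'" "T \<ge> 0"
  shows "(LINT t|lebesgue_on {0<..<T}. v' t) = v T - v 0"
proof -
  obtain S where S: "finite S" "\<And>t. t \<in> {0<..<T} - S \<Longrightarrow> (v has_vector_derivative v' t) (at t)"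
    and v: "continuous_on {0..T} v" "bdd_borel_on {0<..<T} v'"
    using assms unfolding pw_deriv_def by blast
  have "(v' has_integral (v T - v 0)) {0..T}"
    by (rule fundamental_theorem_of_calculus_interior_strong[OF S(1) assms(2) S(2) v(1)])
  then have "integral {0<..<T} v' = v T - v 0"
    using integral_open_interval[of 0 T v'] by (simp add: box_real integral_unique)
  moreover have "integrable (lebesgue_on {0<..<T}) v'"
    by (rule bdd_borel_on_integrable[OF v(2)]) auto
  ultimately show ?thesis
    by (simp add: lebesgue_integral_eq_integral)
qed

lemma pw_deriv_C1:
  assumes "\<And>t. (v has_vector_derivative v' t) (at t)" "continuous_on UNIV v'"
  shows "pw_deriv T v v'"
proof -
  have v: "continuous_on UNIV v"
    by (intro continuous_at_imp_continuous_on ballI has_vector_derivative_continuous[OF assms(1)])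
  show ?thesis
    unfolding pw_deriv_def
    using assms continuous_on_subset[OF v] bdd_borel_on_continuous[OF v]
      bdd_borel_on_continuous[OF assms(2)]
    by (intro conjI exI[of _ "{}"]) auto
qed

lemma test_function_line:
  fixes A :: "'a::euclidean_space set"
  assumes \<phi>: "\<phi> \<in> test_functions (A \<times> I)"
  shows "((\<lambda>t. \<phi> (x, t)) has_vector_derivative frechet_derivative \<phi> (at (x, t)) (0, 1)) (at t)"
proof -
  have "((\<lambda>t. (x, t)) has_derivative (\<lambda>s. (0, s))) (at t)"
    by (auto intro!: derivative_eq_intros)
  from has_derivative_compose[OF this test_function_has_derivative[OF \<phi>]]
  have *: "((\<lambda>t. \<phi> (x, t)) has_derivative (\<lambda>s. frechet_derivative \<phi> (at (x, t)) (0, s))) (at t)" .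
  have lin: "linear (\<lambda>s. frechet_derivative \<phi> (at (x, t)) (0, s))"
    using * by (rule has_derivative_linear)
  have "(\<lambda>s. frechet_derivative \<phi> (at (x, t)) (0, s)) =
      (\<lambda>s. s *\<^sub>R frechet_derivative \<phi> (at (x, t)) (0, 1))"
  proof
    show "frechet_derivative \<phi> (at (x, t)) (0, s) = s *\<^sub>R frechet_derivative \<phi> (at (x, t)) (0, 1)" for s :: real
      using linear_cmul[OF lin, of s 1] by simp
  qed
  from *[unfolded this] show ?thesis
    by (simp only: has_vector_derivative_def)
qed

lemma test_function_eq_0:
  "\<phi> \<in> test_functions U \<Longrightarrow> z \<notin> U \<Longrightarrow> \<phi> z = 0"
  using closure_subset[of "{z. \<phi> z \<noteq> 0}"] by (auto simp: test_functions_def)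

text \<open>Here x is the outer variable, and for each x one integrates by parts in t. Jumps of v'
  do no harm because v is continuous, and the boundary terms vanish because (x, 0) and (x, T) lie
  outside the open cylinder.\<close>

lemma has_weak_deriv_tensor_time:
  fixes A :: "'a::euclidean_space set"
  assumes f: "f \<in> L2 A" and v: "pw_deriv T v v'" and T: "T \<ge> 0"
    and A: "bounded A" "A \<in> sets borel"
  shows "has_weak_deriv (A \<times> {0<..<T}) (0, 1) (\<lambda>z. v (snd z) * f (fst z)) (\<lambda>z. v' (snd z) * f (fst z))"
  unfolding has_weak_deriv_def
proof
  let ?I = "{0<..<T}"
  fix \<phi> assume \<phi>: "\<phi> \<in> test_functions (A \<times> ?I)"
  have A': "A \<in> lmeasurable"
    using A by (auto simp: bounded_set_imp_lmeasurable)
  have I: "bounded ?I" "?I \<in> sets borel" by auto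
  have Fub: "(LINT z|lebesgue_on (A \<times> ?I). w (snd z) * f (fst z) * k z) =
      (LINT x|lebesgue_on A. f x * (LINT t|lebesgue_on ?I. w t * k (x, t)))"
    if w: "bdd_borel_on ?I w" and k: "continuous_on UNIV k" for w k
  proof -
    note K = bdd_borel_on_times_continuous[OF w k A I]
    obtain C where C: "\<And>z. z \<in> A \<times> ?I \<Longrightarrow> norm (w (snd z) * k z) \<le> C"
      using K(2) by blast
    have "(LINT z|lebesgue_on (A \<times> ?I). f (fst z) * (w (snd z) * k z)) =
        (LINT x|lebesgue_on A. f x * (LINT t|lebesgue_on ?I. w t * k (x, t)))"
      using integral_times_lebesgue_on_fst[OF A(2) I(2,1) L2_imp_integrable[OF f A'] K(1) C] by simp
    then show ?thesis
      by (simp add: mult.left_commute[of "f _"] mult.assoc)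
  qed
  have e: "(0, 1) \<in> (Basis :: ('a \<times> real) set)" by (auto simp: Basis_prod_def)
  let ?d = "\<lambda>z. frechet_derivative \<phi> (at z) (0, 1)"
  note dcont = test_function_deriv_continuous[OF \<phi> e]
  have v': "bdd_borel_on ?I v" "bdd_borel_on ?I v'"
    using v by (auto simp: pw_deriv_def)
  have "(LINT t|lebesgue_on ?I. v t * ?d (x, t)) = - (LINT t|lebesgue_on ?I. v' t * \<phi> (x, t))" for x
  proof -
    have w: "pw_deriv T (\<lambda>t. \<phi> (x, t)) (\<lambda>t. ?d (x, t))"
    proof (rule pw_deriv_C1)
      show "((\<lambda>t. \<phi> (x, t)) has_vector_derivative ?d (x, t)) (at t)" for t
        by (rule test_function_line[OF \<phi>])
      show "continuous_on UNIV (\<lambda>t. ?d (x, t))"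
        by (rule continuous_on_compose2[OF dcont]) (auto intro!: continuous_intros)
    qed
    have "(LINT t|lebesgue_on ?I. v t * ?d (x, t) + v' t * \<phi> (x, t)) = v T * \<phi> (x, T) - v 0 * \<phi> (x, 0)"
      by (rule pw_deriv_integral[OF pw_deriv_mult[OF v w] T])
    also have "\<dots> = 0"
      using test_function_eq_0[OF \<phi>] by simp
    finally have "(LINT t|lebesgue_on ?I. v t * ?d (x, t) + v' t * \<phi> (x, t)) = 0" .
    moreover have "integrable (lebesgue_on ?I) (\<lambda>t. v t * ?d (x, t))"
        "integrable (lebesgue_on ?I) (\<lambda>t. v' t * \<phi> (x, t))"
      using w v' I by (auto simp: pw_deriv_def intro!: bdd_borel_on_integrable bdd_borel_on_mult)
    ultimately show ?thesis
      by (simp add: eq_neg_iff_add_eq_0)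
  qed
  then show "(LINT z|lebesgue_on (A \<times> ?I). v (snd z) * f (fst z) * ?d z) =
      - (LINT z|lebesgue_on (A \<times> ?I). v' (snd z) * f (fst z) * \<phi> z)"
    by (simp add: Fub[OF v'(1) dcont] Fub[OF v'(2) test_function_continuous[OF \<phi>]])
qed

section \<open>Splines as piecewise differentiable functions of time\<close>

lemma spline_piece_exists:
  assumes "T > 0" "N \<ge> 1" "t \<in> {0<..<T} - (\<lambda>j. real j * (T / real N)) ` {..N}"
  shows "\<exists>j\<in>{1..N}. t \<in> {real (j - 1) * (T / real N)<..<real j * (T / real N)}"
proof -
  define h where "h = T / real N"
  have h: "h > 0" "real N * h = T" using assms by (auto simp: h_def)
  \<comment> \<open>Pieces are numbered from 1, so t in (i h, (i + 1) h) belongs to piece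
    \<open>Suc i\<close>. The floor gives only i h <= t; strictness comes from t not being a
    node.\<close>
  define i where "i = nat \<lfloor>t / h\<rfloor>"
  have th: "0 \<le> t / h" using assms h by auto
  then have "real i \<le> t / h" "t / h < real i + 1"
    unfolding i_def by linarith+
  then have i: "real i * h \<le> t" "t < real (Suc i) * h"
    using h by (auto simp: field_simps)
  have "real i * h < real N * h"
    using i assms(3) h(2) by auto
  then have "i < N" using h(1) by (metis mult_right_less_imp_less of_nat_less_iff less_imp_le)
  then have "t \<noteq> real i * h" using assms(3) unfolding h_def[symmetric] by auto
  with i \<open>i < N\<close> show ?thesis
    unfolding h_def[symmetric] by (intro bexI[of _ "Suc i"]) auto
qed

text \<open>Off the nodes v is a sum of polynomials cut off by indicators. The finitely many node
  values, unconstrained for q = 0, affect neither Borel measurability nor boundedness; the bound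
  adds them in explicitly.\<close>

lemma spline_bdd_borel:
  assumes v: "v \<in> spline_space T N q" and T: "T > 0" "N \<ge> 1"
  shows "bdd_borel_on {0<..<T} v"
proof -
  define J where "J j = {real (j - 1) * (T / real N)<..<real j * (T / real N)}" for j
  define S where "S = (\<lambda>j. real j * (T / real N)) ` {..N}"
  have S: "finite S" by (simp add: S_def)
  have "\<forall>j\<in>{1..N}. \<exists>P. \<forall>t\<in>J j. v t = poly P (of_real t)"
    using v unfolding spline_space_def J_def by auto
  then obtain P where P: "\<And>j t. j \<in> {1..N} \<Longrightarrow> t \<in> J j \<Longrightarrow> v t = poly (P j) (of_real t)"
    by metis
  have piece: "\<exists>j\<in>{1..N}. t \<in> J j" if "t \<in> {0<..<T} - S" for t
    using spline_piece_exists[of T N t] that T by (simp add: S_def J_def)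
  have J_sub: "J j \<subseteq> {0<..<T}" if "j \<in> {1..N}" for j
  proof
    fix t assume t: "t \<in> J j"
    have "real j * (T / real N) \<le> real N * (T / real N)"
      using that T by (intro mult_right_mono) auto
    moreover have "0 \<le> real (j - 1) * (T / real N)" using T by simp
    moreover have "real (j - 1) * (T / real N) < t" "t < real j * (T / real N)"
      using t by (simp_all only: J_def greaterThanLessThan_iff)
    moreover have "real N * (T / real N) = T" using T by simp
    ultimately show "t \<in> {0<..<T}" by (simp only: greaterThanLessThan_iff) linarith
  qed
  have J_disj: "j = k" if "t \<in> J j" "t \<in> J k" for t j k
  proof -
    have False if "t \<in> J j" "t \<in> J k" "j < k" for j k
    proof -
      have "real j * (T / real N) \<le> real (k - 1) * (T / real N)"
        using that T by (intro mult_right_mono) auto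
      then show False using that by (auto simp: J_def)
    qed
    then show ?thesis using that by (metis nat_neq_iff)
  qed
  have cont: "continuous_on UNIV (\<lambda>t. poly (P j) (complex_of_real t))" for j
    by (intro continuous_intros)
  define g where "g t = (\<Sum>j\<in>{1..N}. indicator (J j) t * poly (P j) (of_real t))" for t
  have "g \<in> borel_measurable borel"
    unfolding g_def using borel_measurable_continuous_onI[OF cont]
    by (intro borel_measurable_sum borel_measurable_times borel_measurable_indicator)
      (auto simp: J_def)
  then have "(\<lambda>t. indicator {0<..<T} t * v t) \<in> borel_measurable borel"
  proof (rule measurable_discrete_difference[where X = S])
    fix t assume t: "t \<notin> S"
    show "g t = indicator {0<..<T} t * v t"
    proof (cases "t \<in> {0<..<T}")
      case True
      then obtain j where j: "j \<in> {1..N}" "t \<in> J j" using piece t by blast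
      have "g t = (\<Sum>k\<in>{j}. indicator (J k) t * poly (P k) (of_real t))"
        unfolding g_def using j J_disj
        by (intro sum.mono_neutral_right) (auto simp: indicator_def)
      then show ?thesis using j True P by simp
    next
      case False
      then have "t \<notin> J j" if "j \<in> {1..N}" for j using J_sub[OF that] by blast
      then show ?thesis using False unfolding g_def by (simp add: sum.neutral)
    qed
  qed (use S in \<open>auto intro: countable_finite\<close>)
  moreover have "\<exists>C. \<forall>t\<in>{0<..<T}. norm (poly (P j) (complex_of_real t)) \<le> C" for j
    using bdd_borel_on_continuous[OF cont, of "{0<..<T}" j] by (auto simp: bdd_borel_on_def)
  then obtain C where C: "\<And>j t. t \<in> {0<..<T} \<Longrightarrow> norm (poly (P j) (complex_of_real t)) \<le> C j"
    by metis
  have "norm (v t) \<le> (\<Sum>j\<in>{1..N}. \<bar>C j\<bar>) + (\<Sum>s\<in>S. norm (v s))" if t: "t \<in> {0<..<T}" for t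
  proof (cases "t \<in> S")
    case True
    then have "norm (v t) \<le> (\<Sum>s\<in>S. norm (v s))"
      using S by (intro member_le_sum) auto
    then show ?thesis by (intro add_increasing sum_nonneg) auto
  next
    case False
    then obtain j where j: "j \<in> {1..N}" "t \<in> J j" using piece t by blast
    have "norm (v t) \<le> \<bar>C j\<bar>" using P[OF j] C[OF t, of j] by simp
    also have "\<dots> \<le> (\<Sum>j\<in>{1..N}. \<bar>C j\<bar>)"
      using j by (intro member_le_sum) auto
    finally show ?thesis by (intro add_increasing2 sum_nonneg) auto
  qed
  ultimately show ?thesis
    unfolding bdd_borel_on_def by blast
qed

text \<open>The derivative is taken within [0, T] to agree with \<open>Ck_on\<close>, whose
  recursion then yields the smoothness of \<open>v'\<close> for q >= 2. For q = 1 it may be a junk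
  value at the nodes, where splines of degree 0 are unconstrained and \<open>pw_deriv\<close> allows
  finitely many exceptions.\<close>

lemma
  assumes v: "v \<in> spline_space T N q" and T: "T > 0" "N \<ge> 1" and q: "q \<ge> 1"
  defines "v' \<equiv> \<lambda>t. frechet_derivative v (at t within {0..T}) 1"
  shows spline_deriv_spline: "v' \<in> spline_space T N (q - 1)"
    and spline_pw_deriv: "pw_deriv T v v'"
proof -
  let ?J = "\<lambda>j. {real (j - 1) * (T / real N)<..<real j * (T / real N)}"
  have der: "(v has_vector_derivative v' t) (at t) \<and> v' t = poly (pderiv P) (of_real t)"
    if j: "j \<in> {1..N}" and P: "\<forall>t\<in>?J j. v t = poly P (of_real t)" and t: "t \<in> ?J j" for j P t
  proof -
    have "((\<lambda>t. poly P (complex_of_real t)) has_vector_derivative poly (pderiv P) (of_real t)) (at t)"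
      by (intro has_vector_derivative_real_field poly_DERIV)
    then have vd: "(v has_vector_derivative poly (pderiv P) (of_real t)) (at t)"
      by (rule has_vector_derivative_transform_within_open[of _ _ _ "?J j"]) (use t P in auto)
    have "real j * (T / real N) \<le> real N * (T / real N)"
      using j T by (intro mult_right_mono) auto
    moreover have "0 \<le> real (j - 1) * (T / real N)" using T by simp
    moreover have "real (j - 1) * (T / real N) < t" "t < real j * (T / real N)"
      using t by (simp_all only: greaterThanLessThan_iff)
    moreover have "real N * (T / real N) = T" using T by simp
    ultimately have "t \<in> {0<..<T}" by (simp only: greaterThanLessThan_iff) linarith
    then have "at t within {0..T} = at t"
      by (intro at_within_interior) auto
    then have "v' t = poly (pderiv P) (of_real t)"
      using frechet_derivative_at[OF vd[unfolded has_vector_derivative_def]]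
      unfolding v'_def by (metis scaleR_one)
    with vd show ?thesis by simp
  qed
  have pieces: "\<exists>P. degree P \<le> q \<and> (\<forall>t\<in>?J j. v t = poly P (of_real t))" if "j \<in> {1..N}" for j
    using v that unfolding spline_space_def by blast
  have "\<exists>P. degree P \<le> q - 1 \<and> (\<forall>t\<in>?J j. v' t = poly P (of_real t))" if j: "j \<in> {1..N}" for j
  proof -
    obtain P where P: "degree P \<le> q" "\<forall>t\<in>?J j. v t = poly P (of_real t)"
      using pieces[OF j] by blast
    show ?thesis
      using der[OF j P(2)] P(1) by (intro exI[of _ "pderiv P"]) (auto simp: degree_pderiv)
  qed
  moreover have "Ck_on (q - 1 - 1) {0..T} v'" if q': "q - 1 \<ge> 1"
  proof -
    have "Ck_on (Suc (q - 1 - 1)) {0..T} v"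
      using v q q' unfolding spline_space_def by (simp add: Suc_diff_Suc del: Ck_on.simps)
    then show ?thesis by (simp add: v'_def)
  qed
  ultimately show v'_spline: "v' \<in> spline_space T N (q - 1)"
    unfolding spline_space_def by blast
  have "(v has_vector_derivative v' t) (at t)"
    if t: "t \<in> {0<..<T} - (\<lambda>j. real j * (T / real N)) ` {..N}" for t
  proof -
    obtain j where j: "j \<in> {1..N}" "t \<in> ?J j"
      using spline_piece_exists[OF T t] by blast
    then show ?thesis using pieces[OF j(1)] der[OF j(1) _ j(2)] by blast
  qed
  moreover have "continuous_on {0..T} v"
    using v q Ck_on_imp_continuous_on unfolding spline_space_def by blast
  moreover have "finite ((\<lambda>j. real j * (T / real N)) ` {..N})" by simp
  ultimately show "pw_deriv T v v'"
    unfolding pw_deriv_def using spline_bdd_borel[OF v T] spline_bdd_borel[OF v'_spline T]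
    by blast
qed

section \<open>Sesquilinear forms and the conservation argument\<close>

lemma bdd_borel_on_const: "bounded I \<Longrightarrow> I \<in> sets borel \<Longrightarrow> bdd_borel_on I (\<lambda>t. c)"
  by (rule bdd_borel_on_continuous) auto

lemma bdd_borel_on_sum:
  assumes "\<And>j. j \<in> J \<Longrightarrow> bdd_borel_on I (z j)" "bounded I" "I \<in> sets borel"
  shows "bdd_borel_on I (\<lambda>t. \<Sum>j\<in>J. c j * z j t)"
  using assms(1)
proof (induction J rule: infinite_finite_induct)
  case (insert j J)
  then show ?case
    by (simp add: bdd_borel_on_add bdd_borel_on_mult bdd_borel_on_const assms(2,3))
qed (simp_all add: bdd_borel_on_const assms(2,3))

section \<open>Pairing and orthogonal projection in time\<close>

definition time_prod :: "real \<Rightarrow> (real \<Rightarrow> complex) \<Rightarrow> (real \<Rightarrow> complex) \<Rightarrow> complex" where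
  "time_prod T v w = (LINT t|lebesgue_on {0<..<T}. v t * cnj (w t))"

lemma time_prod_commute: "time_prod T w v = cnj (time_prod T v w)"
  unfolding time_prod_def Bochner_Integration.integral_cnj[symmetric] by (simp add: mult.commute)

lemma time_prod_integrable:
  assumes "bdd_borel_on {0<..<T} v" "bdd_borel_on {0<..<T} w"
  shows "integrable (lebesgue_on {0<..<T}) (\<lambda>t. v t * cnj (w t))"
  using assms by (intro bdd_borel_on_integrable bdd_borel_on_mult bdd_borel_on_cnj) auto

lemma time_prod_diff_left:
  assumes "bdd_borel_on {0<..<T} u" "bdd_borel_on {0<..<T} v" "bdd_borel_on {0<..<T} w"
  shows "time_prod T (\<lambda>t. u t - c * v t) w = time_prod T u w - c * time_prod T v w"
  using time_prod_integrable[OF assms(1,3)] time_prod_integrable[OF assms(2,3)]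
  by (simp add: time_prod_def left_diff_distrib mult.assoc)

lemma time_prod_sum_right:
  assumes "bdd_borel_on {0<..<T} u" "\<And>j. j \<in> J \<Longrightarrow> bdd_borel_on {0<..<T} (z j)"
  shows "time_prod T u (\<lambda>t. \<Sum>j\<in>J. c j * z j t) = (\<Sum>j\<in>J. cnj (c j) * time_prod T u (z j))"
proof -
  have "time_prod T u (\<lambda>t. \<Sum>j\<in>J. c j * z j t) =
      (LINT t|lebesgue_on {0<..<T}. (\<Sum>j\<in>J. cnj (c j) * (u t * cnj (z j t))))"
    by (simp add: time_prod_def sum_distrib_left mult.left_commute)
  also have "\<dots> = (\<Sum>j\<in>J. cnj (c j) * time_prod T u (z j))"
    unfolding time_prod_def using time_prod_integrable[OF assms]
    by (subst Bochner_Integration.integral_sum) auto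
  finally show ?thesis .
qed

text \<open>Such an e vanishes almost everywhere. This settles the degenerate Gram-Schmidt step,
  where the new vector already lies in the span up to a null set.\<close>

lemma time_prod_eq_0_if_self_eq_0:
  assumes e: "bdd_borel_on {0<..<T} e" and "time_prod T e e = 0"
  shows "time_prod T u e = 0"
proof -
  have int: "integrable (lebesgue_on {0<..<T}) (\<lambda>t. (norm (e t))\<^sup>2)"
    using integrable_norm[OF time_prod_integrable[OF e e]] by (simp add: complex_mod_mult_cnj)
  have "complex_of_real (LINT t|lebesgue_on {0<..<T}. (norm (e t))\<^sup>2) = time_prod T e e"
    unfolding time_prod_def complex_norm_square[symmetric] using int by (rule integral_of_real[symmetric])
  then have "(LINT t|lebesgue_on {0<..<T}. (norm (e t))\<^sup>2) = 0"
    using assms(2) by simp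
  then have "AE t in lebesgue_on {0<..<T}. (norm (e t))\<^sup>2 = 0"
    using integral_nonneg_eq_0_iff_AE[OF int] by simp
  then have "AE t in lebesgue_on {0<..<T}. u t * cnj (e t) = 0"
    by eventually_elim simp
  then show ?thesis
    unfolding time_prod_def by (rule integral_eq_zero_AE)
qed

text \<open>Gram-Schmidt without independence of the \<open>z j\<close>, since the derivatives it is
  applied to may be dependent or zero. The induction is over all u because its hypothesis is used
  for u and for the new vector \<open>z a\<close>.\<close>

lemma time_prod_projection:
  assumes "finite J" "bdd_borel_on {0<..<T} u" "\<And>j. j \<in> J \<Longrightarrow> bdd_borel_on {0<..<T} (z j)"
  shows "\<exists>c. \<forall>i\<in>J. time_prod T (\<lambda>t. u t - (\<Sum>j\<in>J. c j * z j t)) (z i) = 0"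
  using assms
proof (induction J arbitrary: u rule: finite_induct)
  case (insert a J)
  note z = insert.prems(2)
  have bdd: "bdd_borel_on {0<..<T} (\<lambda>t. f t - (\<Sum>j\<in>J. c j * z j t))"
    if "bdd_borel_on {0<..<T} f" for f c
    using bdd_borel_on_add[OF that bdd_borel_on_sum[of J "{0<..<T}" z "\<lambda>j. - c j"]] z
    by (simp add: sum_negf)
  obtain d where d: "\<And>i. i \<in> J \<Longrightarrow> time_prod T (\<lambda>t. z a t - (\<Sum>j\<in>J. d j * z j t)) (z i) = 0"
    using insert.IH[of "z a"] z by auto
  obtain b where b: "\<And>i. i \<in> J \<Longrightarrow> time_prod T (\<lambda>t. u t - (\<Sum>j\<in>J. b j * z j t)) (z i) = 0"
    using insert.IH[of u] insert.prems by auto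
  define e where "e t = z a t - (\<Sum>j\<in>J. d j * z j t)" for t
  define r where "r t = u t - (\<Sum>j\<in>J. b j * z j t)" for t
  have er: "bdd_borel_on {0<..<T} e" "bdd_borel_on {0<..<T} r"
    unfolding e_def r_def using z insert.prems(1) by (auto intro: bdd)
  \<comment> \<open>Coefficient of the residual r along e. If e is null, every pairing with e is
    already 0 and no correction is made.\<close>
  define l where "l = (if time_prod T e e = 0 then 0 else time_prod T r e / time_prod T e e)"
  define s where "s t = r t - l * e t" for t
  have s_bdd: "bdd_borel_on {0<..<T} s"
    using bdd_borel_on_add[OF er(2) bdd_borel_on_mult[OF bdd_borel_on_const er(1), of "- l"]]
    by (simp add: s_def[abs_def])
  have s_z: "time_prod T s (z i) = 0" if "i \<in> J" for i
    using d[OF that] b[OF that] er z that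
    by (simp add: s_def[abs_def] time_prod_diff_left e_def[abs_def, symmetric] r_def[abs_def, symmetric])
  have "time_prod T s e = time_prod T r e - l * time_prod T e e"
    unfolding s_def by (rule time_prod_diff_left[OF er(2,1,1)])
  then have s_e: "time_prod T s e = 0"
    using time_prod_eq_0_if_self_eq_0[OF er(1)] by (cases "time_prod T e e = 0") (simp_all add: l_def)
  have "time_prod T s (z a) = 0"
  proof -
    \<comment> \<open>Orthogonality to e and to the \<open>z j\<close> passes to \<open>z a\<close>,
      which is e plus the sum of the d j * z j; one sum over \<open>insert a J\<close> fits
      \<open>time_prod_sum_right\<close>.\<close>
    have "z a = (\<lambda>t. \<Sum>j\<in>insert a J. (if j = a then 1 else d j) * (if j = a then e else z j) t)"
    proof
      fix t
      have "(\<Sum>j\<in>J. (if j = a then 1 else d j) * (if j = a then e else z j) t) = (\<Sum>j\<in>J. d j * z j t)"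
        using insert.hyps by (intro sum.cong) auto
      then show "z a t = (\<Sum>j\<in>insert a J. (if j = a then 1 else d j) * (if j = a then e else z j) t)"
        using insert.hyps by (simp add: e_def)
    qed
    then have "time_prod T s (z a) = time_prod T s
        (\<lambda>t. \<Sum>j\<in>insert a J. (if j = a then 1 else d j) * (if j = a then e else z j) t)"
      by (rule arg_cong)
    also have "\<dots> = (\<Sum>j\<in>insert a J. cnj (if j = a then 1 else d j) * time_prod T s (if j = a then e else z j))"
      by (rule time_prod_sum_right[OF s_bdd]) (use er z in auto)
    also have "\<dots> = 0"
      using s_z s_e by (intro sum.neutral) auto
    finally show ?thesis .
  qed
  \<comment> \<open>Collecting u - sum b j z j - l (z a - sum d j z j) gives the coefficient l at a
    and b j - l d j elsewhere.\<close>
  moreover have "s = (\<lambda>t. u t - (\<Sum>j\<in>insert a J. (if j = a then l else b j - l * d j) * z j t))"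
  proof
    fix t
    have "(\<Sum>j\<in>J. (if j = a then l else b j - l * d j) * z j t) = (\<Sum>j\<in>J. (b j - l * d j) * z j t)"
      using insert.hyps by (intro sum.cong) auto
    then show "s t = u t - (\<Sum>j\<in>insert a J. (if j = a then l else b j - l * d j) * z j t)"
      using insert.hyps
      by (simp add: s_def r_def e_def left_diff_distrib sum_subtractf sum_distrib_left algebra_simps)
  qed
  ultimately show ?case
    using s_z by (intro exI[of _ "\<lambda>j. if j = a then l else b j - l * d j"]) (metis insert_iff)
qed simp

text \<open>If H is the Gram matrix of a spatial form on functions phi k, this is the corresponding
  space-time form of sum a k phi k and sum b l phi l, while \<open>quad\<close> is the spatial form
  of one such function with itself at a fixed time.\<close>

definition sesq :: "real \<Rightarrow> 'k set \<Rightarrow> ('k \<Rightarrow> 'k \<Rightarrow> complex) \<Rightarrow>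
    ('k \<Rightarrow> real \<Rightarrow> complex) \<Rightarrow> ('k \<Rightarrow> real \<Rightarrow> complex) \<Rightarrow> complex" where
  "sesq T K H a b = (\<Sum>k\<in>K. \<Sum>l\<in>K. time_prod T (a k) (b l) * H k l)"

definition quad :: "'k set \<Rightarrow> ('k \<Rightarrow> 'k \<Rightarrow> complex) \<Rightarrow> ('k \<Rightarrow> real \<Rightarrow> complex) \<Rightarrow> real \<Rightarrow> complex" where
  "quad K H v t = (\<Sum>k\<in>K. \<Sum>l\<in>K. v k t * cnj (v l t) * H k l)"

lemma sesq_commute:
  assumes "\<And>k l. k \<in> K \<Longrightarrow> l \<in> K \<Longrightarrow> H l k = cnj (H k l)"
  shows "sesq T K H b a = cnj (sesq T K H a b)"
proof -
  have "sesq T K H b a = (\<Sum>l\<in>K. \<Sum>k\<in>K. time_prod T (b k) (a l) * H k l)"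
    unfolding sesq_def by (rule sum.swap)
  also have "\<dots> = (\<Sum>k\<in>K. \<Sum>l\<in>K. cnj (time_prod T (a k) (b l) * H k l))"
  proof (intro sum.cong refl)
    fix k l assume "k \<in> K" "l \<in> K"
    then have "H l k = cnj (H k l)"
      by (rule assms)
    moreover have "time_prod T (b l) (a k) = cnj (time_prod T (a k) (b l))"
      by (rule time_prod_commute)
    ultimately show "time_prod T (b l) (a k) * H l k = cnj (time_prod T (a k) (b l) * H k l)"
      by (simp only: complex_cnj_mult)
  qed
  finally show ?thesis by (simp add: sesq_def)
qed

text \<open>Agreement is asked of the pairings, not of the functions: a projection changes the
  functions but keeps the relevant pairings.\<close>

lemma sesq_cong:
  assumes "\<And>k l. k \<in> K \<Longrightarrow> l \<in> K \<Longrightarrow> time_prod T (a k) (b l) = time_prod T (a' k) (b' l)"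
  shows "sesq T K H a b = sesq T K H a' b'"
  unfolding sesq_def using assms by (intro sum.cong refl) simp

text \<open>The product rule for v k * cnj (v l), integrated over (0, T) entry by entry.\<close>

lemma quad_increment:
  assumes T: "T \<ge> 0" and v: "\<And>k. k \<in> K \<Longrightarrow> pw_deriv T (v k) (v' k)"
  shows "quad K H v T - quad K H v 0 = sesq T K H v v' + sesq T K H v' v"
proof -
  have "v k T * cnj (v l T) - v k 0 * cnj (v l 0) = time_prod T (v k) (v' l) + time_prod T (v' k) (v l)"
    if "k \<in> K" "l \<in> K" for k l
  proof -
    note d = pw_deriv_mult[OF v[OF that(1)] pw_deriv_cnj[OF v[OF that(2)]]]
    have b: "bdd_borel_on {0<..<T} (v k)" "bdd_borel_on {0<..<T} (v l)"
        "bdd_borel_on {0<..<T} (v' k)" "bdd_borel_on {0<..<T} (v' l)"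
      using v that by (auto simp: pw_deriv_def)
    show ?thesis
      using pw_deriv_integral[OF d T] time_prod_integrable[OF b(1,4)] time_prod_integrable[OF b(3,2)]
      by (simp add: time_prod_def)
  qed
  then show ?thesis
    unfolding quad_def sesq_def sum_subtractf[symmetric] sum.distrib[symmetric]
    by (intro sum.cong refl) (simp flip: left_diff_distrib distrib_right)
qed

text \<open>
  Testing with \<open>v'\<close> gives the conservation law for \<open>H\<close>; testing with the projection of \<open>v\<close> onto
  the span of the \<open>v' j\<close> gives the one for \<open>M\<close>.
\<close>

lemma quad_conservation:
  fixes v v' :: "'k \<Rightarrow> real \<Rightarrow> complex"
  assumes T: "T \<ge> 0" and K: "finite K" and v: "\<And>k. k \<in> K \<Longrightarrow> pw_deriv T (v k) (v' k)"
    and M: "\<And>k l. k \<in> K \<Longrightarrow> l \<in> K \<Longrightarrow> M l k = cnj (M k l)"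
    and H: "\<And>k l. k \<in> K \<Longrightarrow> l \<in> K \<Longrightarrow> H l k = cnj (H k l)"
    and eq: "\<And>c. \<i> * sesq T K M v' (\<lambda>l t. \<Sum>j\<in>K. c l j * v' j t)
                + sesq T K H v (\<lambda>l t. \<Sum>j\<in>K. c l j * v' j t) = 0"
  shows "quad K M v T = quad K M v 0" "quad K H v T = quad K H v 0"
proof -
  have b: "bdd_borel_on {0<..<T} (v k)" "bdd_borel_on {0<..<T} (v' k)" if "k \<in> K" for k
    using v[OF that] by (auto simp: pw_deriv_def)
  \<comment> \<open>Kronecker coefficients, exhibiting each \<open>v' l\<close> itself as one of the
    admissible combinations.\<close>
  define \<delta> where "\<delta> l j = (if j = l then 1 else 0 :: complex)" for l j :: 'k
  have \<delta>: "(\<lambda>t. \<Sum>j\<in>K. \<delta> l j * v' j t) = v' l" if "l \<in> K" for l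
    using that K by (auto simp: \<delta>_def if_distrib[of "\<lambda>x. x * _"] cong: if_cong)
  have "\<i> * sesq T K M v' v' + sesq T K H v v' = 0"
    using eq[of \<delta>] sesq_cong[where T = T and K = K and H = M and a = v' and b = "\<lambda>l t. \<Sum>j\<in>K. \<delta> l j * v' j t" and a' = v' and b' = v']
      sesq_cong[where T = T and K = K and H = H and a = v and b = "\<lambda>l t. \<Sum>j\<in>K. \<delta> l j * v' j t" and a' = v and b' = v'] \<delta> by simp
  moreover have "Im (sesq T K M v' v') = 0"
    using sesq_commute[where T = T and K = K and H = M and a = v' and b = v', OF M] by (simp add: complex_eq_iff)
  \<comment> \<open>i times a real number is imaginary, so the other summand has real part 0. By
    \<open>quad_increment\<close> and Hermitian symmetry, twice this real part is the increment of
    the quadratic form.\<close>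
  ultimately have "Re (sesq T K H v v') = 0"
    by (simp add: complex_eq_iff)
  then show "quad K H v T = quad K H v 0"
    using quad_increment[where v = v and v' = v' and K = K and H = H, OF T v] sesq_commute[where T = T and K = K and H = H and a = v and b = v', OF H]
    by (simp add: complex_eq_iff)
  have "\<forall>l\<in>K. \<exists>c. \<forall>i\<in>K. time_prod T (\<lambda>t. v l t - (\<Sum>j\<in>K. c j * v' j t)) (v' i) = 0"
    by (intro ballI time_prod_projection K b)
  then obtain c where c: "\<And>l i. l \<in> K \<Longrightarrow> i \<in> K \<Longrightarrow>
      time_prod T (\<lambda>t. v l t - (\<Sum>j\<in>K. c l j * v' j t)) (v' i) = 0"
    by metis
  define w where "w l t = (\<Sum>j\<in>K. c l j * v' j t)" for l t
  have w: "bdd_borel_on {0<..<T} (w l)" for l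
    unfolding w_def by (rule bdd_borel_on_sum) (use b in auto)
  have orth: "time_prod T (v l) (v' i) = time_prod T (w l) (v' i)" if "l \<in> K" "i \<in> K" for l i
    using c[OF that] time_prod_diff_left[OF b(1)[OF that(1)] w b(2)[OF that(2)], of 1 l]
    by (simp add: w_def[abs_def])
  have 1: "time_prod T (v' k) (w l) = time_prod T (v' k) (v l)" if "k \<in> K" "l \<in> K" for k l
    using orth[OF that(2,1)] time_prod_commute by metis
  \<comment> \<open>Conjugate linearity in the second slot reduces this to \<open>orth\<close>,
    because \<open>w l\<close> is a combination of the \<open>v' j\<close>.\<close>
  have 2: "time_prod T (v k) (w l) = time_prod T (w k) (w l)" if "k \<in> K" "l \<in> K" for k l
  proof -
    have "time_prod T u (w l) = (\<Sum>j\<in>K. cnj (c l j) * time_prod T u (v' j))" if "bdd_borel_on {0<..<T} u" for u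
      unfolding w_def by (rule time_prod_sum_right) (use that b in auto)
    then show ?thesis using b(1) w orth that by simp
  qed
  have "\<i> * sesq T K M v' v + sesq T K H w w = 0"
    using eq[of c] sesq_cong[where T = T and K = K and H = M and a = v' and b = w and a' = v' and b' = v, OF 1] sesq_cong[where T = T and K = K and H = H and a = v and b = w and a' = w and b' = w, OF 2]
    by (simp add: w_def[abs_def])
  moreover have "Im (sesq T K H w w) = 0"
    using sesq_commute[where T = T and K = K and H = H and a = w and b = w, OF H] by (simp add: complex_eq_iff)
  ultimately have "Re (sesq T K M v' v) = 0"
    by (simp add: complex_eq_iff)
  then show "quad K M v T = quad K M v 0"
    using quad_increment[where v = v and v' = v' and K = K and H = M, OF T v] sesq_commute[where T = T and K = K and H = M and a = v' and b = v, OF M]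
    by (simp add: complex_eq_iff)
qed

section \<open>The space-time forms on tensor products\<close>

text \<open>Products are peeled off the span one at a time. The scalar is absorbed into the spatial
  factor, which is where closure of \<open>Sx\<close> under scaling enters; the factors obtained may
  be dependent.\<close>

lemma tensor_decomposition:
  assumes U: "U \<in> tensor St Sx" and Sx: "finite_dim_subspace Sx"
  obtains n :: nat and v \<phi> where "\<And>k. k < n \<Longrightarrow> v k \<in> St" "\<And>k. k < n \<Longrightarrow> \<phi> k \<in> Sx"
    "\<And>z. U z = (\<Sum>k<n. v k (snd z) * \<phi> k (fst z))"
proof -
  have scale: "(\<lambda>x. c * \<Phi> x) \<in> Sx" if "\<Phi> \<in> Sx" for c \<Phi>
    using Sx that cfun.span_scale unfolding finite_dim_subspace_def by blast
  have "\<exists>(n::nat) v \<phi>. (\<forall>k<n. v k \<in> St \<and> \<phi> k \<in> Sx) \<and>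
      (\<forall>z. U z = (\<Sum>k<n. v k (snd z) * \<phi> k (fst z)))"
    using U unfolding tensor_def
  proof (induction rule: cfun.span_induct_alt)
    case base
    show ?case by (intro exI[of _ 0]) simp
  next
    case (step c x y)
    from step(1) obtain w \<Phi> where w: "x = (\<lambda>(x, t). w t * \<Phi> x)" "w \<in> St" "\<Phi> \<in> Sx" by blast
    from step(2) obtain n v \<phi> where n: "\<forall>k<n. v k \<in> St \<and> \<phi> k \<in> Sx"
        "\<forall>z. y z = (\<Sum>k<n::nat. v k (snd z) * \<phi> k (fst z))" by blast
    define v' where "v' = v(n := w)"
    define \<phi>' where "\<phi>' = \<phi>(n := (\<lambda>x. c * \<Phi> x))"
    have "v' k \<in> St \<and> \<phi>' k \<in> Sx" if "k < Suc n" for k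
      using that n(1) w scale by (cases "k = n") (auto simp: v'_def \<phi>'_def)
    moreover have "((\<lambda>z. c * x z) + y) z = (\<Sum>k<Suc n. v' k (snd z) * \<phi>' k (fst z))" for z
    proof -
      have "(\<Sum>k<n. v' k (snd z) * \<phi>' k (fst z)) = (\<Sum>k<n. v k (snd z) * \<phi> k (fst z))"
        by (intro sum.cong) (auto simp: v'_def \<phi>'_def)
      also have "\<dots> = y z"
        by (rule n(2)[rule_format, symmetric])
      finally show ?thesis
        using w(1) by (simp add: v'_def \<phi>'_def case_prod_beta)
    qed
    ultimately show ?case by blast
  qed
  then show ?thesis using that by blast
qed

lemma sum_fun_apply: "(\<Sum>i\<in>I. f i) z = (\<Sum>i\<in>I. f i z :: 'a::comm_monoid_add)"
  by (induction I rule: infinite_finite_induct) auto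

text \<open>This is the shape of the test functions in the conservation argument: each spatial
  factor carries its own combination of the same time functions, so the sum runs over K x J.\<close>

lemma sum_tensor_in_tensor:
  assumes "\<And>j. j \<in> J \<Longrightarrow> w j \<in> St" "\<And>k. k \<in> K \<Longrightarrow> \<phi> k \<in> Sx"
  shows "(\<lambda>z. \<Sum>k\<in>K. (\<Sum>j\<in>J. c k j * w j (snd z)) * \<phi> k (fst z)) \<in> tensor St Sx"
proof -
  have "(\<Sum>(k, j)\<in>K \<times> J. (\<lambda>z. c k j * (w j (snd z) * \<phi> k (fst z)))) \<in> tensor St Sx"
    unfolding tensor_def
  proof (rule cfun.span_sum)
    fix p assume "p \<in> K \<times> J"
    then obtain k j where p: "p = (k, j)" "k \<in> K" "j \<in> J"
      by (cases p) auto
    have "(\<lambda>(x, t). w j t * \<phi> k x) \<in> {\<lambda>(x, t). v t * \<Phi> x | v \<Phi>. v \<in> St \<and> \<Phi> \<in> Sx}"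
      by (intro CollectI exI[of _ "w j"] exI[of _ "\<phi> k"] conjI refl assms p)
    from cfun.span_scale[OF cfun.span_base[OF this], of "c k j"]
    show "(case p of (k, j) \<Rightarrow> \<lambda>z. c k j * (w j (snd z) * \<phi> k (fst z)))
        \<in> cfun.span {\<lambda>(x, t). v t * \<Phi> x | v \<Phi>. v \<in> St \<and> \<Phi> \<in> Sx}"
      by (simp only: p(1) prod.case case_prod_beta fst_conv snd_conv)
  qed
  moreover have "(\<Sum>(k, j)\<in>K \<times> J. (\<lambda>z. c k j * (w j (snd z) * \<phi> k (fst z)))) =
      (\<lambda>z. \<Sum>k\<in>K. (\<Sum>j\<in>J. c k j * w j (snd z)) * \<phi> k (fst z))"
  proof
    fix z
    have "(\<Sum>(k, j)\<in>K \<times> J. (\<lambda>z. c k j * (w j (snd z) * \<phi> k (fst z)))) z =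
        (\<Sum>(k, j)\<in>K \<times> J. c k j * (w j (snd z) * \<phi> k (fst z)))"
      unfolding sum_fun_apply by (intro sum.cong refl) auto
    then show "(\<Sum>(k, j)\<in>K \<times> J. (\<lambda>z. c k j * (w j (snd z) * \<phi> k (fst z)))) z =
        (\<Sum>k\<in>K. (\<Sum>j\<in>J. c k j * w j (snd z)) * \<phi> k (fst z))"
      by (simp add: sum.cartesian_product[symmetric] sum_distrib_right mult.assoc)
  qed
  ultimately show ?thesis by simp
qed

lemma integral_double_sum:
  fixes h :: "'k \<Rightarrow> 'l \<Rightarrow> 'a \<Rightarrow> complex"
  assumes "\<And>k l. k \<in> K \<Longrightarrow> l \<in> L \<Longrightarrow> integrable M (h k l)"
  shows "(LINT x|M. (\<Sum>k\<in>K. \<Sum>l\<in>L. h k l x)) = (\<Sum>k\<in>K. \<Sum>l\<in>L. integral\<^sup>L M (h k l))"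
proof -
  have "(LINT x|M. (\<Sum>k\<in>K. \<Sum>l\<in>L. h k l x)) = (\<Sum>k\<in>K. LINT x|M. (\<Sum>l\<in>L. h k l x))"
    by (intro Bochner_Integration.integral_sum Bochner_Integration.integrable_sum assms)
  also have "\<dots> = (\<Sum>k\<in>K. \<Sum>l\<in>L. integral\<^sup>L M (h k l))"
    by (intro sum.cong refl Bochner_Integration.integral_sum assms)
  finally show ?thesis .
qed

text \<open>The families f and g are kept separate so that the potential can be absorbed into
  f.\<close>

lemma integral_tensor_sums:
  fixes A :: "'a::euclidean_space set"
  assumes fg: "\<And>k l. k \<in> K \<Longrightarrow> l \<in> K \<Longrightarrow> integrable (lebesgue_on A) (\<lambda>x. f k x * cnj (g l x))"
    and a: "\<And>k. k \<in> K \<Longrightarrow> bdd_borel_on {0<..<T} (a k)"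
    and b: "\<And>k. k \<in> K \<Longrightarrow> bdd_borel_on {0<..<T} (b k)"
    and A: "bounded A" "A \<in> sets borel"
  shows "(LINT z|lebesgue_on (A \<times> {0<..<T}).
      (\<Sum>k\<in>K. a k (snd z) * f k (fst z)) * cnj (\<Sum>l\<in>K. b l (snd z) * g l (fst z))) =
    sesq T K (\<lambda>k l. LINT x|lebesgue_on A. f k x * cnj (g l x)) a b"
proof -
  let ?M = "lebesgue_on (A \<times> {0<..<T})"
  let ?h = "\<lambda>k l z. (f k (fst z) * cnj (g l (fst z))) * (a k (snd z) * cnj (b l (snd z)))"
  have kl: "integrable ?M (?h k l)"
      "integral\<^sup>L ?M (?h k l) = time_prod T (a k) (b l) * (LINT x|lebesgue_on A. f k x * cnj (g l x))"
    if "k \<in> K" "l \<in> K" for k l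
  proof -
    have c: "bdd_borel_on {0<..<T} (\<lambda>t. a k t * cnj (b l t))"
      using that a b by (intro bdd_borel_on_mult bdd_borel_on_cnj)
    show "integrable ?M (?h k l)"
      by (rule integrable_tensor[OF fg[OF that] c A]) auto
    show "integral\<^sup>L ?M (?h k l) = time_prod T (a k) (b l) * (LINT x|lebesgue_on A. f k x * cnj (g l x))"
      unfolding time_prod_def by (subst integral_tensor[OF fg[OF that] c A]) auto
  qed
  have "(LINT z|?M. (\<Sum>k\<in>K. a k (snd z) * f k (fst z)) * cnj (\<Sum>l\<in>K. b l (snd z) * g l (fst z))) =
      (LINT z|?M. (\<Sum>k\<in>K. \<Sum>l\<in>K. ?h k l z))"
    by (intro Bochner_Integration.integral_cong refl) (simp add: sum_product ac_simps)
  also have "\<dots> = (\<Sum>k\<in>K. \<Sum>l\<in>K. integral\<^sup>L ?M (?h k l))"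
    by (intro integral_double_sum kl(1))
  also have "\<dots> = sesq T K (\<lambda>k l. LINT x|lebesgue_on A. f k x * cnj (g l x)) a b"
    unfolding sesq_def using kl(2) by (intro sum.cong refl)
  finally show ?thesis .
qed

text \<open>The real weight lets one identity serve the mass and the gradient components (weight 1)
  as well as the potential energy (weight V).\<close>

lemma integral_square_sum:
  assumes f: "\<And>k l. k \<in> K \<Longrightarrow> l \<in> K \<Longrightarrow> integrable M (\<lambda>x. of_real (r x) * f k x * cnj (f l x))"
  shows "complex_of_real (LINT x|M. r x * (norm (\<Sum>k\<in>K. v k t * f k x))\<^sup>2) =
    quad K (\<lambda>k l. LINT x|M. of_real (r x) * f k x * cnj (f l x)) v t"
proof -
  let ?h = "\<lambda>k l x. v k t * cnj (v l t) * (of_real (r x) * f k x * cnj (f l x))"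
  have eq: "complex_of_real (r x * (norm (\<Sum>k\<in>K. v k t * f k x))\<^sup>2) = (\<Sum>k\<in>K. \<Sum>l\<in>K. ?h k l x)" for x
  proof -
    have "complex_of_real (r x * (norm (\<Sum>k\<in>K. v k t * f k x))\<^sup>2) =
        of_real (r x) * ((\<Sum>k\<in>K. v k t * f k x) * (\<Sum>l\<in>K. cnj (v l t * f l x)))"
      by (simp only: of_real_mult complex_norm_square cnj_sum)
    also have "\<dots> = (\<Sum>k\<in>K. \<Sum>l\<in>K. of_real (r x) * ((v k t * f k x) * cnj (v l t * f l x)))"
      unfolding sum_product by (simp only: sum_distrib_left)
    also have "\<dots> = (\<Sum>k\<in>K. \<Sum>l\<in>K. ?h k l x)"
      by (intro sum.cong refl) simp
    finally show ?thesis .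
  qed
  have "complex_of_real (LINT x|M. r x * (norm (\<Sum>k\<in>K. v k t * f k x))\<^sup>2) =
      (LINT x|M. (\<Sum>k\<in>K. \<Sum>l\<in>K. ?h k l x))"
    unfolding eq[symmetric] by (rule integral_complex_of_real[symmetric])
  also have "\<dots> = (\<Sum>k\<in>K. \<Sum>l\<in>K. integral\<^sup>L M (?h k l))"
    by (intro integral_double_sum integrable_mult_right f)
  finally show ?thesis by (simp add: quad_def)
qed

lemma AE_L2_prod_cong:
  assumes "u \<in> L2 Q" "u' \<in> L2 Q" "w \<in> L2 Q" "w' \<in> L2 Q"
    and "AE z in lebesgue_on Q. u z = u' z" "AE z in lebesgue_on Q. w z = w' z"
  shows "(LINT z|lebesgue_on Q. u z * cnj (w z)) = (LINT z|lebesgue_on Q. u' z * cnj (w' z))"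
proof (rule integral_cong_AE)
  show "AE z in lebesgue_on Q. u z * cnj (w z) = u' z * cnj (w' z)"
    using assms(5,6) by eventually_elim simp
qed (rule borel_measurable_integrable[OF L2_integrable_mult_cnj] assms)+

lemma integrable_bounded_mult:
  fixes g :: "'a::euclidean_space \<Rightarrow> complex"
  assumes V: "V \<in> Linfinity U" and g: "integrable (lebesgue_on U) g"
  shows "integrable (lebesgue_on U) (\<lambda>x. of_real (V x) * g x)"
proof -
  obtain C where C: "AE x in lebesgue_on U. \<bar>V x\<bar> \<le> C" and [measurable]: "V \<in> borel_measurable (lebesgue_on U)"
    using V by (auto simp: Linfinity_def)
  have [measurable]: "g \<in> borel_measurable (lebesgue_on U)"
    using g by (rule borel_measurable_integrable)
  have "integrable (lebesgue_on U) (\<lambda>x. C * norm (g x))"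
    using g by auto
  then show ?thesis
  proof (rule Bochner_Integration.integrable_bound)
    show "AE x in lebesgue_on U. norm (of_real (V x) * g x) \<le> norm (C * norm (g x))"
      using C
    proof eventually_elim
      case (elim x)
      then show ?case
        by (auto simp: norm_mult abs_mult intro!: mult_right_mono)
    qed
  qed measurable
qed

lemma
  fixes \<Omega> :: "(real^'d) set"
  assumes "open \<Omega>" "bounded \<Omega>" "u \<in> H1 \<Omega>"
  shows H1_weak_deriv_L2: "weak_deriv \<Omega> (axis i 1) u \<in> L2 \<Omega>"
    and H1_has_weak_deriv: "has_weak_deriv \<Omega> (axis i 1) u (weak_deriv \<Omega> (axis i 1) u)"
proof -
  obtain g where g: "g \<in> L2 \<Omega>" "has_weak_deriv \<Omega> (axis i 1) u g"
    using assms(3) unfolding H1_def by blast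
  show "weak_deriv \<Omega> (axis i 1) u \<in> L2 \<Omega>"
      "has_weak_deriv \<Omega> (axis i 1) u (weak_deriv \<Omega> (axis i 1) u)"
    using weak_deriv_L2[OF assms(1,2) g] has_weak_deriv_weak_deriv[OF assms(1,2) g] by auto
qed

lemma sesq_add_scale:
  "sesq T K (\<lambda>k l. c * F k l + G k l) a b = c * sesq T K F a b + sesq T K G a b"
  by (simp add: sesq_def sum.distrib sum_distrib_left algebra_simps)

lemma sesq_sum: "sesq T K (\<lambda>k l. \<Sum>i\<in>I. F i k l) a b = (\<Sum>i\<in>I. sesq T K (F i) a b)"
proof -
  have "sesq T K (\<lambda>k l. \<Sum>i\<in>I. F i k l) a b = (\<Sum>k\<in>K. \<Sum>i\<in>I. \<Sum>l\<in>K. time_prod T (a k) (b l) * F i k l)"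
    unfolding sesq_def sum_distrib_left by (intro sum.cong refl sum.swap)
  also have "\<dots> = (\<Sum>i\<in>I. sesq T K (F i) a b)"
    unfolding sesq_def by (rule sum.swap)
  finally show ?thesis .
qed

lemma quad_add_scale:
  "quad K (\<lambda>k l. c * F k l + G k l) v t = c * quad K F v t + quad K G v t"
  by (simp add: quad_def sum.distrib sum_distrib_left algebra_simps)

lemma quad_sum: "quad K (\<lambda>k l. \<Sum>i\<in>I. F i k l) v t = (\<Sum>i\<in>I. quad K (F i) v t)"
proof -
  have "quad K (\<lambda>k l. \<Sum>i\<in>I. F i k l) v t = (\<Sum>k\<in>K. \<Sum>i\<in>I. \<Sum>l\<in>K. v k t * cnj (v l t) * F i k l)"
    unfolding quad_def sum_distrib_left by (intro sum.cong refl sum.swap)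
  also have "\<dots> = (\<Sum>i\<in>I. quad K (F i) v t)"
    unfolding quad_def by (rule sum.swap)
  finally show ?thesis .
qed

lemma L2_tensor_sum:
  fixes A :: "'a::euclidean_space set"
  assumes "\<And>k. k \<in> K \<Longrightarrow> f k \<in> L2 A" "\<And>k. k \<in> K \<Longrightarrow> bdd_borel_on {0<..<T} (a k)"
    and "bounded A" "A \<in> sets borel"
  shows "(\<lambda>z. \<Sum>k\<in>K. a k (snd z) * f k (fst z)) \<in> L2 (A \<times> {0<..<T})"
proof -
  have "(\<lambda>z. \<Sum>k\<in>K. 1 * (a k (snd z) * f k (fst z))) \<in> L2 (A \<times> {0<..<T})"
  proof (rule L2_sum)
    fix k assume "k \<in> K"
    then show "(\<lambda>z. a k (snd z) * f k (fst z)) \<in> L2 (A \<times> {0<..<T})"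
      using assms by (intro L2_tensor) auto
  qed
  then show ?thesis by simp
qed

lemma has_weak_deriv_tensor_sum_space:
  fixes \<Omega> :: "'a::euclidean_space set"
  assumes \<Omega>: "open \<Omega>" "bounded \<Omega>" and e: "e \<in> Basis"
    and f: "\<And>k. k \<in> K \<Longrightarrow> f k \<in> L2 \<Omega>" and g: "\<And>k. k \<in> K \<Longrightarrow> g k \<in> L2 \<Omega>"
    and wd: "\<And>k. k \<in> K \<Longrightarrow> has_weak_deriv \<Omega> e (f k) (g k)"
    and a: "\<And>k. k \<in> K \<Longrightarrow> bdd_borel_on {0<..<T} (a k)"
  shows "has_weak_deriv (\<Omega> \<times> {0<..<T}) (e, 0) (\<lambda>z. \<Sum>k\<in>K. a k (snd z) * f k (fst z))
    (\<lambda>z. \<Sum>k\<in>K. a k (snd z) * g k (fst z))"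
proof -
  have "has_weak_deriv (\<Omega> \<times> {0<..<T}) (e, 0) (\<lambda>z. \<Sum>k\<in>K. 1 * (a k (snd z) * f k (fst z)))
    (\<lambda>z. \<Sum>k\<in>K. 1 * (a k (snd z) * g k (fst z)))"
  proof (rule has_weak_deriv_sum)
    show "open (\<Omega> \<times> {0<..<T})" "bounded (\<Omega> \<times> {0<..<T})"
      using \<Omega> by (auto intro: open_Times bounded_Times)
    show "(e, 0) \<in> Basis" using e by (auto simp: Basis_prod_def)
    fix k assume k: "k \<in> K"
    note B = \<Omega>(2) borel_open[OF \<Omega>(1)]
    show "(\<lambda>z. a k (snd z) * f k (fst z)) \<in> L2 (\<Omega> \<times> {0<..<T})"
      by (rule L2_tensor[OF f[OF k] a[OF k] B]) auto
    show "(\<lambda>z. a k (snd z) * g k (fst z)) \<in> L2 (\<Omega> \<times> {0<..<T})"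
      by (rule L2_tensor[OF g[OF k] a[OF k] B]) auto
    show "has_weak_deriv (\<Omega> \<times> {0<..<T}) (e, 0) (\<lambda>z. a k (snd z) * f k (fst z))
        (\<lambda>z. a k (snd z) * g k (fst z))"
      by (rule has_weak_deriv_tensor_space[OF f[OF k] g[OF k] wd[OF k] e a[OF k] B]) auto
  qed
  then show ?thesis by simp
qed

lemma has_weak_deriv_tensor_sum_time:
  fixes \<Omega> :: "'a::euclidean_space set"
  assumes \<Omega>: "open \<Omega>" "bounded \<Omega>" and T: "T \<ge> 0"
    and f: "\<And>k. k \<in> K \<Longrightarrow> f k \<in> L2 \<Omega>" and v: "\<And>k. k \<in> K \<Longrightarrow> pw_deriv T (v k) (v' k)"
  shows "has_weak_deriv (\<Omega> \<times> {0<..<T}) (0, 1) (\<lambda>z. \<Sum>k\<in>K. v k (snd z) * f k (fst z))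
    (\<lambda>z. \<Sum>k\<in>K. v' k (snd z) * f k (fst z))"
proof -
  have "has_weak_deriv (\<Omega> \<times> {0<..<T}) (0, 1) (\<lambda>z. \<Sum>k\<in>K. 1 * (v k (snd z) * f k (fst z)))
    (\<lambda>z. \<Sum>k\<in>K. 1 * (v' k (snd z) * f k (fst z)))"
  proof (rule has_weak_deriv_sum)
    show "open (\<Omega> \<times> {0<..<T})" "bounded (\<Omega> \<times> {0<..<T})"
      using \<Omega> by (auto intro: open_Times bounded_Times)
    show "(0, 1) \<in> (Basis :: ('a \<times> real) set)" by (auto simp: Basis_prod_def)
    fix k assume k: "k \<in> K"
    note B = \<Omega>(2) borel_open[OF \<Omega>(1)]
    have b: "bdd_borel_on {0<..<T} (v k)" "bdd_borel_on {0<..<T} (v' k)"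
      using v[OF k] by (auto simp: pw_deriv_def)
    show "(\<lambda>z. v k (snd z) * f k (fst z)) \<in> L2 (\<Omega> \<times> {0<..<T})"
      by (rule L2_tensor[OF f[OF k] b(1) B]) auto
    show "(\<lambda>z. v' k (snd z) * f k (fst z)) \<in> L2 (\<Omega> \<times> {0<..<T})"
      by (rule L2_tensor[OF f[OF k] b(2) B]) auto
    show "has_weak_deriv (\<Omega> \<times> {0<..<T}) (0, 1) (\<lambda>z. v k (snd z) * f k (fst z))
        (\<lambda>z. v' k (snd z) * f k (fst z))"
      by (rule has_weak_deriv_tensor_time[OF f[OF k] v[OF k] T B])
  qed
  then show ?thesis by simp
qed

section \<open>Gram matrices of the spatial factors and the forms they represent\<close>

definition mass_form :: "'a::euclidean_space set \<Rightarrow> ('k \<Rightarrow> 'a \<Rightarrow> complex) \<Rightarrow> 'k \<Rightarrow> 'k \<Rightarrow> complex" where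
  "mass_form \<Omega> \<phi> k l = (LINT x|lebesgue_on \<Omega>. \<phi> k x * cnj (\<phi> l x))"

definition potential_form ::
  "'a::euclidean_space set \<Rightarrow> ('k \<Rightarrow> 'a \<Rightarrow> complex) \<Rightarrow> ('a \<Rightarrow> real) \<Rightarrow> 'k \<Rightarrow> 'k \<Rightarrow> complex" where
  "potential_form \<Omega> \<phi> V k l = (LINT x|lebesgue_on \<Omega>. of_real (V x) * \<phi> k x * cnj (\<phi> l x))"

definition grad_form ::
  "(real^'d) set \<Rightarrow> ('k \<Rightarrow> real^'d \<Rightarrow> complex) \<Rightarrow> 'k \<Rightarrow> 'k \<Rightarrow> complex" where
  "grad_form \<Omega> \<phi> k l = (\<Sum>i\<in>UNIV. LINT x|lebesgue_on \<Omega>.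
     weak_deriv \<Omega> (axis i 1) (\<phi> k) x * cnj (weak_deriv \<Omega> (axis i 1) (\<phi> l) x))"

lemma form_hermitian:
  "mass_form \<Omega> \<phi> l k = cnj (mass_form \<Omega> \<phi> k l)"
  "potential_form \<Omega> \<phi> V l k = cnj (potential_form \<Omega> \<phi> V k l)"
  "grad_form \<Omega> \<phi> l k = cnj (grad_form \<Omega> \<phi> k l)"
  unfolding mass_form_def potential_form_def grad_form_def cnj_sum Bochner_Integration.integral_cnj[symmetric]
  by (simp_all add: mult.commute mult.left_commute)

context
  fixes \<Omega> :: "(real^'d) set" and T :: real and K :: "'k set" and \<phi> :: "'k \<Rightarrow> real^'d \<Rightarrow> complex"
  assumes \<Omega>: "open \<Omega>" "bounded \<Omega>" and T: "T > 0"
    and \<phi>: "\<And>k. k \<in> K \<Longrightarrow> \<phi> k \<in> H1 \<Omega>"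
begin

lemma phi_L2: "k \<in> K \<Longrightarrow> \<phi> k \<in> L2 \<Omega>"
  using \<phi> by (auto simp: H1_def)

lemma time_deriv_form:
  assumes v: "\<And>k. k \<in> K \<Longrightarrow> pw_deriv T (v k) (v' k)"
    and b: "\<And>k. k \<in> K \<Longrightarrow> bdd_borel_on {0<..<T} (b k)"
  shows "L2_prod (cylinder \<Omega> T) (time_deriv \<Omega> T (\<lambda>z. \<Sum>k\<in>K. v k (snd z) * \<phi> k (fst z)))
      (\<lambda>z. \<Sum>k\<in>K. b k (snd z) * \<phi> k (fst z)) = sesq T K (mass_form \<Omega> \<phi>) v' b"
proof -
  let ?Q = "\<Omega> \<times> {0<..<T}"
  note B = \<Omega>(2) borel_open[OF \<Omega>(1)]
  have v': "bdd_borel_on {0<..<T} (v' k)" if "k \<in> K" for k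
    using v[OF that] by (simp add: pw_deriv_def)
  have Q: "open ?Q" "bounded ?Q"
    using \<Omega> by (auto intro: open_Times bounded_Times)
  note L2s = L2_tensor_sum[OF phi_L2 v' B] L2_tensor_sum[OF phi_L2 b B]
  have wd: "has_weak_deriv ?Q (0, 1) (\<lambda>z. \<Sum>k\<in>K. v k (snd z) * \<phi> k (fst z))
      (\<lambda>z. \<Sum>k\<in>K. v' k (snd z) * \<phi> k (fst z))"
    using T by (intro has_weak_deriv_tensor_sum_time \<Omega> phi_L2 v) auto
  have "L2_prod (cylinder \<Omega> T) (time_deriv \<Omega> T (\<lambda>z. \<Sum>k\<in>K. v k (snd z) * \<phi> k (fst z)))
      (\<lambda>z. \<Sum>k\<in>K. b k (snd z) * \<phi> k (fst z)) =
      (LINT z|lebesgue_on ?Q. (\<Sum>k\<in>K. v' k (snd z) * \<phi> k (fst z)) * cnj (\<Sum>k\<in>K. b k (snd z) * \<phi> k (fst z)))"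
    unfolding L2_prod_def time_deriv_def cylinder_def
    by (rule AE_L2_prod_cong[OF weak_deriv_L2[OF Q L2s(1) wd] L2s(1) L2s(2) L2s(2)
        AE_weak_deriv_eq[OF Q L2s(1) wd]]) auto
  also have "\<dots> = sesq T K (mass_form \<Omega> \<phi>) v' b"
    unfolding mass_form_def[abs_def]
    by (intro integral_tensor_sums L2_integrable_mult_cnj phi_L2 v' b B)
  finally show ?thesis .
qed

lemma space_grad_form:
  assumes a: "\<And>k. k \<in> K \<Longrightarrow> bdd_borel_on {0<..<T} (a k)"
    and b: "\<And>k. k \<in> K \<Longrightarrow> bdd_borel_on {0<..<T} (b k)"
  shows "L2_prod_vec (cylinder \<Omega> T) (space_grad \<Omega> T (\<lambda>z. \<Sum>k\<in>K. a k (snd z) * \<phi> k (fst z)))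
      (space_grad \<Omega> T (\<lambda>z. \<Sum>k\<in>K. b k (snd z) * \<phi> k (fst z))) = sesq T K (grad_form \<Omega> \<phi>) a b"
proof -
  let ?Q = "\<Omega> \<times> {0<..<T}"
  let ?G = "\<lambda>i k. weak_deriv \<Omega> (axis i 1) (\<phi> k)"
  note B = \<Omega>(2) borel_open[OF \<Omega>(1)]
  have Q: "open ?Q" "bounded ?Q"
    using \<Omega> by (auto intro: open_Times bounded_Times)
  have G: "?G i k \<in> L2 \<Omega>" if "k \<in> K" for i k
    by (rule H1_weak_deriv_L2[OF \<Omega> \<phi>[OF that]])
  let ?D = "\<lambda>i a. weak_deriv ?Q (axis i 1, 0) (\<lambda>z. \<Sum>k\<in>K. a k (snd z) * \<phi> k (fst z))"
  let ?S = "\<lambda>i a z. \<Sum>k\<in>K. a k (snd z) * ?G i k (fst z)"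
  \<comment> \<open>\<open>?D\<close> is the chosen weak derivative on the cylinder,
    \<open>?S\<close> the tensor sum built from those of the spatial factors. The coefficients are
    arbitrary because both slots of the product need this.\<close>
  have D: "?D i a \<in> L2 ?Q \<and> ?S i a \<in> L2 ?Q \<and> (AE z in lebesgue_on ?Q. ?D i a z = ?S i a z)"
    if a: "\<And>k. k \<in> K \<Longrightarrow> bdd_borel_on {0<..<T} (a k)" for a i
  proof -
    have S: "?S i a \<in> L2 ?Q" by (rule L2_tensor_sum[OF G a B])
    have "has_weak_deriv ?Q (axis i 1, 0) (\<lambda>z. \<Sum>k\<in>K. a k (snd z) * \<phi> k (fst z)) (?S i a)"
      by (intro has_weak_deriv_tensor_sum_space \<Omega> phi_L2 G a H1_has_weak_deriv \<phi>)
        (auto simp: axis_in_Basis_iff)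
    with weak_deriv_L2[OF Q S this] AE_weak_deriv_eq[OF Q S this] S show ?thesis by blast
  qed
  have "L2_prod_vec (cylinder \<Omega> T) (space_grad \<Omega> T (\<lambda>z. \<Sum>k\<in>K. a k (snd z) * \<phi> k (fst z)))
      (space_grad \<Omega> T (\<lambda>z. \<Sum>k\<in>K. b k (snd z) * \<phi> k (fst z))) =
      (LINT z|lebesgue_on ?Q. (\<Sum>i\<in>UNIV. ?D i a z * cnj (?D i b z)))"
    by (simp add: L2_prod_vec_def space_grad_def cylinder_def)
  also have "\<dots> = (\<Sum>i\<in>UNIV. LINT z|lebesgue_on ?Q. ?D i a z * cnj (?D i b z))"
    using D[OF a] D[OF b] by (intro Bochner_Integration.integral_sum L2_integrable_mult_cnj) auto
  also have "\<dots> = (\<Sum>i\<in>UNIV. LINT z|lebesgue_on ?Q. ?S i a z * cnj (?S i b z))"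
    using D[OF a] D[OF b] by (intro sum.cong refl AE_L2_prod_cong) auto
  also have "\<dots> = (\<Sum>i\<in>UNIV. sesq T K (\<lambda>k l. LINT x|lebesgue_on \<Omega>. ?G i k x * cnj (?G i l x)) a b)"
    by (intro sum.cong refl integral_tensor_sums L2_integrable_mult_cnj G a b B)
  also have "\<dots> = sesq T K (grad_form \<Omega> \<phi>) a b"
    unfolding grad_form_def[abs_def] by (rule sesq_sum[symmetric])
  finally show ?thesis .
qed

lemma integrable_potential:
  assumes "V \<in> Linfinity \<Omega>" "k \<in> K" "l \<in> K"
  shows "integrable (lebesgue_on \<Omega>) (\<lambda>x. of_real (V x) * \<phi> k x * cnj (\<phi> l x))"
  using integrable_bounded_mult[OF assms(1) L2_integrable_mult_cnj[OF phi_L2[OF assms(2)] phi_L2[OF assms(3)]]]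
  by (simp add: mult.assoc)

lemma potential_prod_form:
  assumes V: "V \<in> Linfinity \<Omega>"
    and a: "\<And>k. k \<in> K \<Longrightarrow> bdd_borel_on {0<..<T} (a k)"
    and b: "\<And>k. k \<in> K \<Longrightarrow> bdd_borel_on {0<..<T} (b k)"
  shows "L2_prod (cylinder \<Omega> T) (\<lambda>(x, t). of_real (V x) * (\<Sum>k\<in>K. a k t * \<phi> k x))
      (\<lambda>z. \<Sum>k\<in>K. b k (snd z) * \<phi> k (fst z)) = sesq T K (potential_form \<Omega> \<phi> V) a b"
proof -
  have "(\<lambda>(x, t). of_real (V x) * (\<Sum>k\<in>K. a k t * \<phi> k x)) =
      (\<lambda>z. \<Sum>k\<in>K. a k (snd z) * (of_real (V (fst z)) * \<phi> k (fst z)))"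
    by (auto simp: fun_eq_iff sum_distrib_left intro!: sum.cong)
  then show ?thesis
    unfolding L2_prod_def cylinder_def potential_form_def[abs_def]
    using integral_tensor_sums[where f = "\<lambda>k x. of_real (V x) * \<phi> k x" and g = \<phi> and K = K and T = T
        and A = \<Omega> and a = a and b = b] integrable_potential[OF V] a b \<Omega> by auto
qed

lemma mass_eq_quad:
  "complex_of_real (mass \<Omega> (\<lambda>z. \<Sum>k\<in>K. v k (snd z) * \<phi> k (fst z)) t) = quad K (mass_form \<Omega> \<phi>) v t"
  using integral_square_sum[where r = "\<lambda>_. 1" and K = K and f = \<phi> and M = "lebesgue_on \<Omega>" and v = v and t = t]
    L2_integrable_mult_cnj[OF phi_L2 phi_L2]
  by (simp add: mass_def mass_form_def[abs_def])

text \<open>The time t is frozen, and it will be 0 or T. The weak gradient is therefore computed on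
  Omega from the sum with constant coefficients v k t; the one on the cylinder sees only the open
  time interval, and only up to null sets.\<close>

lemma energy_eq_quad:
  assumes V: "V \<in> Linfinity \<Omega>"
  shows "complex_of_real (energy \<Omega> V (\<lambda>z. \<Sum>k\<in>K. v k (snd z) * \<phi> k (fst z)) t) =
    quad K (\<lambda>k l. - (1/2) * grad_form \<Omega> \<phi> k l + potential_form \<Omega> \<phi> V k l) v t"
proof -
  let ?G = "\<lambda>i k. weak_deriv \<Omega> (axis i 1) (\<phi> k)"
  let ?D = "\<lambda>i. weak_deriv \<Omega> (axis i 1) (\<lambda>y. \<Sum>k\<in>K. v k t * \<phi> k y)"
  have G: "?G i k \<in> L2 \<Omega>" if "k \<in> K" for i k
    by (rule H1_weak_deriv_L2[OF \<Omega> \<phi>[OF that]])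
  have S: "(\<lambda>x. \<Sum>k\<in>K. v k t * ?G i k x) \<in> L2 \<Omega>" for i
    by (rule L2_sum[OF G])
  have wd: "has_weak_deriv \<Omega> (axis i 1) (\<lambda>y. \<Sum>k\<in>K. v k t * \<phi> k y) (\<lambda>x. \<Sum>k\<in>K. v k t * ?G i k x)" for i
    by (intro has_weak_deriv_sum \<Omega> phi_L2 G H1_has_weak_deriv \<phi>) (auto simp: axis_in_Basis_iff)
  have D: "?D i \<in> L2 \<Omega>" "AE x in lebesgue_on \<Omega>. ?D i x = (\<Sum>k\<in>K. v k t * ?G i k x)" for i
    using weak_deriv_L2[OF \<Omega> S wd] AE_weak_deriv_eq[OF \<Omega> S wd] by auto
  have "(LINT x|lebesgue_on \<Omega>. (norm (grad \<Omega> (\<lambda>y. \<Sum>k\<in>K. v k t * \<phi> k y) x))\<^sup>2) =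
      (LINT x|lebesgue_on \<Omega>. (\<Sum>i\<in>UNIV. (norm (?D i x))\<^sup>2))"
    by (simp add: grad_def norm_vec_def L2_set_def sum_nonneg)
  also have "\<dots> = (\<Sum>i\<in>UNIV. LINT x|lebesgue_on \<Omega>. (norm (?D i x))\<^sup>2)"
    by (intro Bochner_Integration.integral_sum L2_integrable_square D)
  also have "\<dots> = (\<Sum>i\<in>UNIV. LINT x|lebesgue_on \<Omega>. 1 * (norm (\<Sum>k\<in>K. v k t * ?G i k x))\<^sup>2)"
  proof (intro sum.cong refl integral_cong_AE)
    fix i
    show "AE x in lebesgue_on \<Omega>. (norm (?D i x))\<^sup>2 = 1 * (norm (\<Sum>k\<in>K. v k t * ?G i k x))\<^sup>2"
      using D(2)[of i] by eventually_elim simp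
  qed (use borel_measurable_integrable[OF L2_integrable_square[OF D(1)]]
      borel_measurable_integrable[OF L2_integrable_square[OF S]] in auto)
  also have "complex_of_real \<dots> = (\<Sum>i\<in>UNIV. quad K (\<lambda>k l. LINT x|lebesgue_on \<Omega>. ?G i k x * cnj (?G i l x)) v t)"
    unfolding of_real_sum
    by (subst integral_square_sum) (auto intro: L2_integrable_mult_cnj G)
  also have "\<dots> = quad K (grad_form \<Omega> \<phi>) v t"
    unfolding grad_form_def[abs_def] by (rule quad_sum[symmetric])
  finally have grad: "complex_of_real (LINT x|lebesgue_on \<Omega>.
      (norm (grad \<Omega> (\<lambda>y. \<Sum>k\<in>K. v k t * \<phi> k y) x))\<^sup>2) = quad K (grad_form \<Omega> \<phi>) v t" .
  have pot: "complex_of_real (LINT x|lebesgue_on \<Omega>. V x * (norm (\<Sum>k\<in>K. v k t * \<phi> k x))\<^sup>2) =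
      quad K (potential_form \<Omega> \<phi> V) v t"
    unfolding potential_form_def[abs_def] by (intro integral_square_sum integrable_potential V)
  show ?thesis
    unfolding energy_def quad_add_scale by (simp add: grad pot)
qed

end

theorem proposition2p3:
  fixes \<Omega> :: "(real^'d) set" and T :: real and V :: "real^'d \<Rightarrow> real"
    and \<Psi>\<^sub>0 :: "real^'d \<Rightarrow> complex"
    and P\<^sub>h :: "(real^'d \<Rightarrow> complex) \<Rightarrow> (real^'d \<Rightarrow> complex)"
    and S\<^sub>x :: "(real^'d \<Rightarrow> complex) set"
    and N p :: nat and \<Psi> :: "(real^'d) \<times> real \<Rightarrow> complex"
  assumes "lipschitz_domain \<Omega>" and "bounded \<Omega>" and "T > 0" and "V \<in> Linfinity \<Omega>"
    and "\<Psi>\<^sub>0 \<in> H10 \<Omega>"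
    and "N \<ge> 1" and "p \<ge> 1"
    and "finite_dim_subspace S\<^sub>x" and "S\<^sub>x \<subseteq> H10 \<Omega>" and "P\<^sub>h \<Psi>\<^sub>0 \<in> S\<^sub>x"
    and "\<exists>U \<in> tensor (spline_space0 T N p) S\<^sub>x. \<forall>x t. \<Psi> (x, t) = P\<^sub>h \<Psi>\<^sub>0 x + U (x, t)"
    and "\<forall>W \<in> tensor (spline_space T N (p - 1)) S\<^sub>x.
      \<i> * L2_prod (cylinder \<Omega> T) (time_deriv \<Omega> T \<Psi>) W
      - 1/2 * L2_prod_vec (cylinder \<Omega> T) (space_grad \<Omega> T \<Psi>) (space_grad \<Omega> T W)
      + L2_prod (cylinder \<Omega> T) (\<lambda>(x, t). of_real (V x) * \<Psi> (x, t)) W = 0"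
  shows "mass \<Omega> \<Psi> T = mass \<Omega> \<Psi> 0 \<and> energy \<Omega> V \<Psi> T = energy \<Omega> V \<Psi> 0"
proof -
  have \<Omega>: "open \<Omega>" "bounded \<Omega>"
    using assms(1,2) by (auto simp: lipschitz_domain_def)
  note T = assms(3) and V = assms(4)
  obtain U where U: "U \<in> tensor (spline_space0 T N p) S\<^sub>x" "\<And>x t. \<Psi> (x, t) = P\<^sub>h \<Psi>\<^sub>0 x + U (x, t)"
    using assms(11) by blast
  obtain n :: nat and u f where u: "\<And>k. k < n \<Longrightarrow> u k \<in> spline_space0 T N p"
    and f: "\<And>k. k < n \<Longrightarrow> f k \<in> S\<^sub>x" and U_eq: "\<And>z. U z = (\<Sum>k<n. u k (snd z) * f k (fst z))"
    by (rule tensor_decomposition[OF U(1) assms(8)]) (rule that)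
  \<comment> \<open>The initial approximation becomes one more product, with index n, time factor 1
    and derivative 0, so that it is treated like the other terms.\<close>
  define K where "K = {..n}"
  define v where "v = u(n := (\<lambda>_. 1))"
  define \<phi> where "\<phi> = f(n := P\<^sub>h \<Psi>\<^sub>0)"
  define v' where "v' k = (if k < n then (\<lambda>t. frechet_derivative (u k) (at t within {0..T}) 1) else (\<lambda>_. 0))" for k
  have \<Psi>: "\<Psi> = (\<lambda>z. \<Sum>k\<in>K. v k (snd z) * \<phi> k (fst z))"
  proof
    fix z
    have "(\<Sum>k<n. v k (snd z) * \<phi> k (fst z)) = U z"
      unfolding U_eq by (intro sum.cong) (auto simp: v_def \<phi>_def)
    then show "\<Psi> z = (\<Sum>k\<in>K. v k (snd z) * \<phi> k (fst z))"
      using U(2)[of "fst z" "snd z"]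
      by (simp add: K_def v_def \<phi>_def lessThan_Suc_atMost[symmetric])
  qed
  have spline: "u k \<in> spline_space T N p" if "k < n" for k
    using u[OF that] by (simp add: spline_space0_def)
  have v'_spline: "v' k \<in> spline_space T N (p - 1)" if "k < n" for k
    using spline_deriv_spline[OF spline[OF that] T assms(6,7)] that by (simp add: v'_def)
  have v: "pw_deriv T (v k) (v' k)" if "k \<in> K" for k
    using spline_pw_deriv[OF spline T assms(6,7)] pw_deriv_const that
    by (cases "k = n") (auto simp: v_def v'_def K_def)
  have bdd: "bdd_borel_on {0<..<T} (v k)" "bdd_borel_on {0<..<T} (v' k)" if "k \<in> K" for k
    using v[OF that] by (auto simp: pw_deriv_def)
  have \<phi>_S: "\<phi> k \<in> S\<^sub>x" if "k \<in> K" for k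
    using that f assms(10) by (cases "k = n") (auto simp: \<phi>_def K_def)
  then have \<phi>: "\<phi> k \<in> H1 \<Omega>" if "k \<in> K" for k
    using that assms(9) unfolding H10_def by blast
  let ?M = "mass_form \<Omega> \<phi>" and ?G = "grad_form \<Omega> \<phi>" and ?V = "potential_form \<Omega> \<phi> V"
  let ?H = "\<lambda>k l. - (1/2) * ?G k l + ?V k l"
  have eq: "\<i> * sesq T K ?M v' (\<lambda>l t. \<Sum>j\<in>K. c l j * v' j t) + sesq T K ?H v (\<lambda>l t. \<Sum>j\<in>K. c l j * v' j t) = 0" for c
  proof -
    define w where "w l t = (\<Sum>j\<in>K. c l j * v' j t)" for l t
    define W where "W z = (\<Sum>k\<in>K. w k (snd z) * \<phi> k (fst z))" for z
    have w: "bdd_borel_on {0<..<T} (w l)" for l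
      unfolding w_def by (rule bdd_borel_on_sum) (use bdd in auto)
    \<comment> \<open>The index n drops out because its \<open>v'\<close> is 0; the remaining
      \<open>v' j\<close> are those that \<open>v'_spline\<close> places in the temporal test
      space.\<close>
    have w_eq: "w l t = (\<Sum>j<n. c l j * v' j t)" for l t
      unfolding w_def K_def lessThan_Suc_atMost[symmetric] by (simp add: v'_def)
    have "W \<in> tensor (spline_space T N (p - 1)) S\<^sub>x"
      unfolding W_def w_eq by (intro sum_tensor_in_tensor v'_spline \<phi>_S) auto
    then have "\<i> * L2_prod (cylinder \<Omega> T) (time_deriv \<Omega> T \<Psi>) W
      - 1/2 * L2_prod_vec (cylinder \<Omega> T) (space_grad \<Omega> T \<Psi>) (space_grad \<Omega> T W)
      + L2_prod (cylinder \<Omega> T) (\<lambda>(x, t). of_real (V x) * \<Psi> (x, t)) W = 0"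
      using assms(12) by blast
    moreover have "L2_prod (cylinder \<Omega> T) (time_deriv \<Omega> T \<Psi>) W = sesq T K ?M v' w"
      unfolding \<Psi> W_def by (rule time_deriv_form[OF \<Omega> T \<phi> v w])
    moreover have "L2_prod_vec (cylinder \<Omega> T) (space_grad \<Omega> T \<Psi>) (space_grad \<Omega> T W) = sesq T K ?G v w"
      unfolding \<Psi> W_def by (rule space_grad_form[OF \<Omega> T \<phi> bdd(1) w])
    moreover have "L2_prod (cylinder \<Omega> T) (\<lambda>(x, t). of_real (V x) * \<Psi> (x, t)) W = sesq T K ?V v w"
      unfolding \<Psi> W_def fst_conv snd_conv by (rule potential_prod_form[OF \<Omega> T \<phi> V bdd(1) w])
    ultimately show ?thesis
      unfolding sesq_add_scale by (simp add: w_def[abs_def] algebra_simps)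
  qed
  \<comment> \<open>Gradient and potential forms are both Hermitian, and the coefficient -1/2 is
    real.\<close>
  have H: "?H l k = cnj (?H k l)" for k l
  proof -
    have "?G l k = cnj (?G k l)" "?V l k = cnj (?V k l)"
      by (rule form_hermitian)+
    then show ?thesis
      by (simp only: complex_cnj_add complex_cnj_mult) simp
  qed
  have "finite K" by (simp add: K_def)
  note conservation = quad_conservation[where K = K and v = v and v' = v',
      OF less_imp_le[OF T] this v form_hermitian(1) H eq]
  have "complex_of_real (mass \<Omega> \<Psi> t) = quad K ?M v t" for t
    unfolding \<Psi> by (rule mass_eq_quad[OF \<Omega> T \<phi>])
  moreover have "quad K ?M v T = quad K ?M v 0"
    by (rule conservation(1))
  ultimately have "complex_of_real (mass \<Omega> \<Psi> T) = complex_of_real (mass \<Omega> \<Psi> 0)"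
    by (simp only:)
  moreover have "complex_of_real (energy \<Omega> V \<Psi> t) = quad K ?H v t" for t
    unfolding \<Psi> by (rule energy_eq_quad[OF \<Omega> T \<phi> V])
  moreover have "quad K ?H v T = quad K ?H v 0"
    by (rule conservation(2))
  ultimately have "complex_of_real (mass \<Omega> \<Psi> T) = complex_of_real (mass \<Omega> \<Psi> 0)"
      "complex_of_real (energy \<Omega> V \<Psi> T) = complex_of_real (energy \<Omega> V \<Psi> 0)"
    by (simp_all only:)
  then show ?thesis
    by (simp only: of_real_eq_iff)
qed

end
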